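(* Suppose the local functions $f_1,\dots,f_n$ satisfy the smoothness assumption (constant $L_f$), the bounded variance assumption (constant $\sigma$) and the bounded heterogeneity assumption (constants $\varsigma_x,\varsigma_y$), and $f=\frac1n\sum_i f_i$ satisfies the $\mu$-PL condition in $\mathbf y$; let $\kappa=L_f/\mu$ and $\Phi(\mathbf x)=\max_{\mathbf y}f(\mathbf x,\mathbf y)$. Then, to reach an $\epsilon$-accurate point, i.e. an output $\bar{\mathbf x}_T$ with $\mathbb E\|\nabla\Phi(\bar{\mathbf x}_T)\|\le\epsilon$, assuming $T\ge\Theta(n^3)$, the stochastic gradient complexity of Momentum Local SGDA (with suitably chosen $\eta_x,\eta_y,\alpha_t\equiv\alpha,\tau$ and $\beta_x=\beta_y=3$) is $T=\mathcal O(\kappa^4/(n\epsilon^4))$, and the number of communication rounds required for the same is $T/\tau=\mathcal O(\kappa^3/\epsilon^3)$.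
   Context: Setting: $n\ge1$ clients; client $i$ has a local function $f_i:\mathbb R^{d_1}\times\mathbb R^{d_2}\to\mathbb R$, $f_i(\mathbf x,\mathbf y)=\mathbb E_{\xi_i\sim\mathcal D_i}[L(\mathbf x,\mathbf y;\xi_i)]$. The problem is $\min_{\mathbf x}\max_{\mathbf y} f(\mathbf x,\mathbf y)$, $f=\frac1n\sum_i f_i$. $\|\cdot\|$ is the Euclidean norm; $\nabla f_i(\mathbf x,\mathbf y;\xi^i)$ denotes a stochastic gradient at client $i$, with components $\nabla_{\mathbf x},\nabla_{\mathbf y}$. Smoothness: each $f_i$ is differentiable and, for some $L_f>0$, $\|\nabla f_i(\mathbf x,\mathbf y)-\nabla f_i(\mathbf x',\mathbf y')\|\le L_f\|(\mathbf x,\mathbf y)-(\mathbf x',\mathbf y')\|$ for all $i$ and all arguments. Bounded variance: for some $\sigma>0$, for all $i,\mathbf x,\mathbf y$: $\mathbb E_{\xi^i}[\nabla f_i(\mathbf x,\mathbf y;\xi^i)]=\nabla f_i(\mathbf x,\mathbf y)$ and $\mathbb E_{\xi^i}\|\nabla f_i(\mathbf x,\mathbf y;\xi^i)-\nabla f_i(\mathbf x,\mathbf y)\|^2\le\sigma^2$; samples are independent across clients and drawn afresh at each iteration. Bounded heterogeneity: $\varsigma_x^2=\sup_{\mathbf x,\mathbf y}\frac1n\sum_i\|\nabla_{\mathbf x} f_i-\nabla_{\mathbf x} f\|^2$ and $\varsigma_y^2=\sup_{\mathbf x,\mathbf y}\frac1n\sum_i\|\nabla_{\mathbf y} f_i-\nabla_{\mathbf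 y} f\|^2$ are finite. $\mu$-PL condition in $\mathbf y$ ($\mu>0$): for each fixed $\mathbf x$, $\max_{\mathbf y'}f(\mathbf x,\mathbf y')$ has a nonempty solution set, and $\|\nabla_{\mathbf y} f(\mathbf x,\mathbf y)\|^2\ge2\mu(\max_{\mathbf y'}f(\mathbf x,\mathbf y')-f(\mathbf x,\mathbf y))$ for all $\mathbf y$. Momentum Local SGDA (inputs $\mathbf x_0,\mathbf y_0$, $\eta_x,\eta_y>0$, $\beta_x,\beta_y>0$, $\alpha_t>0$, integers $\tau,T\ge1$): $\mathbf x_0^i=\mathbf x_0$, $\mathbf y^i_0=\mathbf y_0$, $\mathbf d^i_{x,0}=\nabla_{\mathbf x} f_i(\mathbf x_0^i,\mathbf y_0^i;\xi_0^i)$, $\mathbf d^i_{y,0}=\nabla_{\mathbf y} f_i(\mathbf x_0^i,\mathbf y_0^i;\xi_0^i)$. For $t=0,\dots,T-1$, each client computes $\widetilde{\mathbf x}^i_{t+1/2}=\mathbf x^i_t-\eta_x\mathbf d^i_{x,t}$, $\mathbf x^i_{t+1}=\mathbf x^i_t+\alpha_t(\widetilde{\mathbf x}^i_{t+1/2}-\mathbf x^i_t)$, $\widetilde{\mathbf y}^i_{t+1/2}=\mathbf y^i_t+\eta_y\mathbf d^i_{y,t}$, $\mathbf y^i_{t+1}=\mathbf y^i_t+\alpha_t(\widetilde{\mathbf y}^i_{t+1/2}-\mathbf y^i_t)$, samples $\xi^i_{t+1}$, and sets $\mathbf d^i_{x,t+1}=(1-\beta_x\alpha_t)\mathbf d^i_{x,t}+\beta_x\alpha_t\nabla_{\mathbf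 x} f_i(\mathbf x^i_{t+1},\mathbf y^i_{t+1};\xi^i_{t+1})$, $\mathbf d^i_{y,t+1}=(1-\beta_y\alpha_t)\mathbf d^i_{y,t}+\beta_y\alpha_t\nabla_{\mathbf y} f_i(\mathbf x^i_{t+1},\mathbf y^i_{t+1};\xi^i_{t+1})$. If $\tau$ divides $t+1$, each of $\mathbf x^i_{t+1},\mathbf y^i_{t+1},\mathbf d^i_{x,t+1},\mathbf d^i_{y,t+1}$ is replaced by its average over clients. With $\mathbf x_t=\frac1n\sum_i\mathbf x_t^i$, the output $\bar{\mathbf x}_T$ is uniform on $\{\mathbf x_0,\dots,\mathbf x_{T-1}\}$. Stochastic gradient complexity: the total number of gradients computed by a single client, which is of order $T$. Communication rounds: the number of times clients communicate with the server, i.e. $\lceil T/\tau\rceil$. The constants hidden in $\mathcal O(\cdot)$ do not depend on $\epsilon$ or $n$ (the step-size $\eta_y$, the modulus $\mu$, $L_f,\sigma,\varsigma_x,\varsigma_y$ and the initialization are treated as constants). The complexity claim means: there are choices of the algorithm parameters with $T$ and $T/\tau$ of the stated orders for which the output is $\epsilon$-accurate.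
   Formalization: It is additionally assumed that Φ is bounded below, with Φ(x_0) − inf Φ at most a constant; without this the claim fails, e.g. for f_i(x,y) = ⟨v,x⟩ − |y|²/2 with |v| = 1, where ∇Φ = v everywhere. *)

theory Defs
  imports "HOL-Probability.Probability"
begin

text \<open>Clients are numbered \<open>0, \<dots>, n - 1\<close>; families indexed by clients are functions on \<^typ>\<open>nat\<close>
  of which only the values at \<open>i < n\<close> matter. A pair \<open>(x, y)\<close> lives in the product space
  \<^typ>\<open>'a::euclidean_space \<times> 'b::euclidean_space\<close>, whose library norm is the Euclidean norm.\<close>

definition avg :: "nat \<Rightarrow> (nat \<Rightarrow> 'v::real_vector) \<Rightarrow> 'v" where
  "avg n v = (1 / real n) *\<^sub>R (\<Sum>i<n. v i)"

text \<open>Meaningful only where the function is differentiable; for functions on a product space, the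
  components of the gradient are the partial gradients.\<close>

definition gradient :: "('v::euclidean_space \<Rightarrow> real) \<Rightarrow> 'v \<Rightarrow> 'v" where
  "gradient f z = (THE D. GDERIV f z :> D)"

lemma gradient_eqI: "GDERIV f z :> D \<Longrightarrow> gradient f z = D"
  unfolding gradient_def gderiv_def
  by (rule the_equality) (auto dest: has_derivative_unique simp: fun_eq_iff vector_eq_ldot)

definition grad_x :: "('a::euclidean_space \<times> 'b::euclidean_space \<Rightarrow> real) \<Rightarrow> 'a \<times> 'b \<Rightarrow> 'a" where
  "grad_x f z = fst (gradient f z)"

definition grad_y :: "('a::euclidean_space \<times> 'b::euclidean_space \<Rightarrow> real) \<Rightarrow> 'a \<times> 'b \<Rightarrow> 'b" where
  "grad_y f z = snd (gradient f z)"

definition local_fun :: "(nat \<Rightarrow> 's measure) \<Rightarrow> ('z \<Rightarrow> 's \<Rightarrow> real) \<Rightarrow> nat \<Rightarrow> 'z \<Rightarrow> real" where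
  "local_fun D loss i z = (\<integral>s. loss z s \<partial>D i)"

definition global_fun :: "nat \<Rightarrow> (nat \<Rightarrow> 'z \<Rightarrow> real) \<Rightarrow> 'z \<Rightarrow> real" where
  "global_fun n f z = avg n (\<lambda>i. f i z)"

text \<open>The supremum is a maximum whenever \<open>PL_in_y\<close> below holds.\<close>

definition max_y :: "('a \<times> 'b \<Rightarrow> real) \<Rightarrow> 'a \<Rightarrow> real" where
  "max_y f x = (SUP y. f (x, y))"

definition smooth_clients ::
  "real \<Rightarrow> nat \<Rightarrow> (nat \<Rightarrow> 'a::euclidean_space \<times> 'b::euclidean_space \<Rightarrow> real) \<Rightarrow> bool" where
  "smooth_clients Lf n f \<longleftrightarrow>
     (\<forall>i<n. (\<forall>z. f i differentiable at z) \<and>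
            (\<forall>z z'. norm (gradient (f i) z - gradient (f i) z') \<le> Lf * norm (z - z')))"

text \<open>\<open>g i z s\<close> is the stochastic gradient of client \<open>i\<close> at \<open>z\<close> for the sample \<open>s\<close>. Joint measurability
  makes its evaluation at random iterates a random variable; the integrability conditions exclude
  the default value \<open>0\<close> of undefined integrals.\<close>

definition bounded_variance ::
  "real \<Rightarrow> nat \<Rightarrow> (nat \<Rightarrow> 's measure) \<Rightarrow>
   (nat \<Rightarrow> 'a::euclidean_space \<times> 'b::euclidean_space \<Rightarrow> real) \<Rightarrow>
   (nat \<Rightarrow> 'a \<times> 'b \<Rightarrow> 's \<Rightarrow> 'a \<times> 'b) \<Rightarrow> bool" where
  "bounded_variance \<sigma> n D f g \<longleftrightarrow>
     (\<forall>i<n. (\<lambda>(z, s). g i z s) \<in> borel_measurable (borel \<Otimes>\<^sub>M D i) \<and>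
       (\<forall>z. integrable (D i) (g i z) \<and>
            (\<integral>s. g i z s \<partial>D i) = gradient (f i) z \<and>
            integrable (D i) (\<lambda>s. (norm (g i z s - gradient (f i) z))\<^sup>2) \<and>
            (\<integral>s. (norm (g i z s - gradient (f i) z))\<^sup>2 \<partial>D i) \<le> \<sigma>\<^sup>2))"

definition heterogeneity_at ::
  "('z \<Rightarrow> 'v::real_normed_vector) \<Rightarrow> nat \<Rightarrow> (nat \<Rightarrow> 'z \<Rightarrow> 'v) \<Rightarrow> 'z \<Rightarrow> real" where
  "heterogeneity_at G n Gi z = avg n (\<lambda>i. (norm (Gi i z - G z))\<^sup>2)"

definition bounded_heterogeneity ::
  "real \<Rightarrow> real \<Rightarrow> nat \<Rightarrow> (nat \<Rightarrow> 'a::euclidean_space \<times> 'b::euclidean_space \<Rightarrow> real) \<Rightarrow> bool" where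
  "bounded_heterogeneity \<zeta>x \<zeta>y n f \<longleftrightarrow>
     (let F = global_fun n f;
          hx = heterogeneity_at (grad_x F) n (\<lambda>i. grad_x (f i));
          hy = heterogeneity_at (grad_y F) n (\<lambda>i. grad_y (f i))
      in bdd_above (range hx) \<and> (SUP z. hx z) \<le> \<zeta>x\<^sup>2 \<and>
         bdd_above (range hy) \<and> (SUP z. hy z) \<le> \<zeta>y\<^sup>2)"

definition PL_in_y ::
  "real \<Rightarrow> ('a::euclidean_space \<times> 'b::euclidean_space \<Rightarrow> real) \<Rightarrow> bool" where
  "PL_in_y \<mu> f \<longleftrightarrow>
     (\<forall>x. \<exists>ym. \<forall>y. f (x, y) \<le> f (x, ym)) \<and>
     (\<forall>x y. (norm (grad_y f (x, y)))\<^sup>2 \<ge> 2 * \<mu> * (max_y f x - f (x, y)))"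

text \<open>\<open>\<xi> i t\<close> is the sample drawn by client \<open>i\<close> at iteration \<open>t\<close>.\<close>

definition fresh_samples ::
  "'w measure \<Rightarrow> nat \<Rightarrow> (nat \<Rightarrow> 's measure) \<Rightarrow> (nat \<Rightarrow> nat \<Rightarrow> 'w \<Rightarrow> 's) \<Rightarrow> bool" where
  "fresh_samples M n D \<xi> \<longleftrightarrow>
     prob_space.indep_vars M (\<lambda>(i, t). D i) (\<lambda>(i, t). \<xi> i t) ({..<n} \<times> UNIV) \<and>
     (\<forall>i<n. \<forall>t. distr M (D i) (\<xi> i t) = D i)"

record ('a, 'b) client_state =
  xc :: 'a
  yc :: 'b
  dx :: 'a
  dy :: 'b

definition local_step ::
  "real \<Rightarrow> real \<Rightarrow> real \<Rightarrow> real \<Rightarrow> real \<Rightarrow>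
   ('a::euclidean_space \<times> 'b::euclidean_space \<Rightarrow> 'a \<times> 'b) \<Rightarrow>
   ('a, 'b) client_state \<Rightarrow> ('a, 'b) client_state" where
  "local_step \<eta>x \<eta>y \<beta>x \<beta>y a G S =
     (let xh = xc S - \<eta>x *\<^sub>R dx S;
          x' = xc S + a *\<^sub>R (xh - xc S);
          yh = yc S + \<eta>y *\<^sub>R dy S;
          y' = yc S + a *\<^sub>R (yh - yc S)
      in \<lparr> xc = x', yc = y',
           dx = (1 - \<beta>x * a) *\<^sub>R dx S + (\<beta>x * a) *\<^sub>R fst (G (x', y')),
           dy = (1 - \<beta>y * a) *\<^sub>R dy S + (\<beta>y * a) *\<^sub>R snd (G (x', y')) \<rparr>)"

definition server_average ::
  "nat \<Rightarrow> (nat \<Rightarrow> ('a::euclidean_space, 'b::euclidean_space) client_state) \<Rightarrow>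
   ('a, 'b) client_state" where
  "server_average n S =
     \<lparr> xc = avg n (\<lambda>i. xc (S i)), yc = avg n (\<lambda>i. yc (S i)),
       dx = avg n (\<lambda>i. dx (S i)), dy = avg n (\<lambda>i. dy (S i)) \<rparr>"

text \<open>\<open>momentum_local_sgda n \<tau> \<eta>x \<eta>y \<beta>x \<beta>y \<alpha> G x0 y0 t i\<close> is the state of client \<open>i\<close> at time \<open>t\<close>,
  where \<open>G i t z\<close> is the stochastic gradient that client \<open>i\<close> obtains at \<open>z\<close> from its time-\<open>t\<close> sample.\<close>

primrec momentum_local_sgda ::
  "nat \<Rightarrow> nat \<Rightarrow> real \<Rightarrow> real \<Rightarrow> real \<Rightarrow> real \<Rightarrow> (nat \<Rightarrow> real) \<Rightarrow>
   (nat \<Rightarrow> nat \<Rightarrow> 'a::euclidean_space \<times> 'b::euclidean_space \<Rightarrow> 'a \<times> 'b) \<Rightarrow>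
   'a \<Rightarrow> 'b \<Rightarrow> nat \<Rightarrow> nat \<Rightarrow> ('a, 'b) client_state" where
  "momentum_local_sgda n \<tau> \<eta>x \<eta>y \<beta>x \<beta>y \<alpha> G x0 y0 0 =
     (\<lambda>i. \<lparr> xc = x0, yc = y0, dx = fst (G i 0 (x0, y0)), dy = snd (G i 0 (x0, y0)) \<rparr>)"
| "momentum_local_sgda n \<tau> \<eta>x \<eta>y \<beta>x \<beta>y \<alpha> G x0 y0 (Suc t) =
     (let S = momentum_local_sgda n \<tau> \<eta>x \<eta>y \<beta>x \<beta>y \<alpha> G x0 y0 t;
          S' = (\<lambda>i. local_step \<eta>x \<eta>y \<beta>x \<beta>y (\<alpha> t) (G i (Suc t)) (S i))
      in if \<tau> dvd Suc t then (\<lambda>i. server_average n S') else S')"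

definition avg_iterate ::
  "nat \<Rightarrow> nat \<Rightarrow> real \<Rightarrow> real \<Rightarrow> real \<Rightarrow> real \<Rightarrow> (nat \<Rightarrow> real) \<Rightarrow>
   (nat \<Rightarrow> 'a::euclidean_space \<times> 'b::euclidean_space \<Rightarrow> 's \<Rightarrow> 'a \<times> 'b) \<Rightarrow>
   (nat \<Rightarrow> nat \<Rightarrow> 'w \<Rightarrow> 's) \<Rightarrow> 'a \<Rightarrow> 'b \<Rightarrow> nat \<Rightarrow> 'w \<Rightarrow> 'a" where
  "avg_iterate n \<tau> \<eta>x \<eta>y \<beta>x \<beta>y \<alpha> g \<xi> x0 y0 t \<omega> =
     avg n (\<lambda>i. xc (momentum_local_sgda n \<tau> \<eta>x \<eta>y \<beta>x \<beta>y \<alpha> (\<lambda>j s z. g j z (\<xi> j s \<omega>)) x0 y0 t i))"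

text \<open>The output is \<open>X t\<close> with \<open>t\<close> uniform on \<open>{..<T}\<close> and independent of the samples, so its
  expectation is taken over a product space. Differentiability and integrability are required
  explicitly because \<open>gradient\<close> and the integral have default values.\<close>

definition accurate_output ::
  "'w measure \<Rightarrow> ('a::euclidean_space \<Rightarrow> real) \<Rightarrow> nat \<Rightarrow> (nat \<Rightarrow> 'w \<Rightarrow> 'a) \<Rightarrow> real \<Rightarrow> bool" where
  "accurate_output M \<Phi> T X \<epsilon> \<longleftrightarrow>
     (let P = M \<Otimes>\<^sub>M measure_pmf (pmf_of_set {..<T});
          err = (\<lambda>(\<omega>, t). norm (gradient \<Phi> (X t \<omega>)))
      in (\<forall>x. \<Phi> differentiable at x) \<and> integrable P err \<and> (\<integral>p. err p \<partial>P) \<le> \<epsilon>)"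

definition communication_rounds :: "nat \<Rightarrow> nat \<Rightarrow> nat" where
  "communication_rounds T \<tau> = nat \<lceil>real T / real \<tau>\<rceil>"

text \<open>A federated minimax problem together with a sampling model for the algorithm started at
  \<open>(x0, y0)\<close>. The last two conditions bound the initialization: \<open>\<Delta>\<Phi>\<close> bounds the initial
  suboptimality gap of \<open>\<Phi> = max_y f\<close> (so \<open>\<Phi>\<close> is bounded below), \<open>\<Delta>y\<close> that of the inner maximization.\<close>

definition minimax_instance ::
  "real \<Rightarrow> real \<Rightarrow> real \<Rightarrow> real \<Rightarrow> real \<Rightarrow> real \<Rightarrow> real \<Rightarrow> nat \<Rightarrow>
   'w measure \<Rightarrow> (nat \<Rightarrow> 's measure) \<Rightarrow>
   ('a::euclidean_space \<times> 'b::euclidean_space \<Rightarrow> 's \<Rightarrow> real) \<Rightarrow>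
   (nat \<Rightarrow> 'a \<times> 'b \<Rightarrow> 's \<Rightarrow> 'a \<times> 'b) \<Rightarrow> (nat \<Rightarrow> nat \<Rightarrow> 'w \<Rightarrow> 's) \<Rightarrow> 'a \<Rightarrow> 'b \<Rightarrow> bool" where
  "minimax_instance Lf \<mu> \<sigma> \<zeta>x \<zeta>y \<Delta>\<Phi> \<Delta>y n M D loss g \<xi> x0 y0 \<longleftrightarrow>
     (let f = local_fun D loss; F = global_fun n f; \<Phi> = max_y F
      in n \<ge> 1 \<and> prob_space M \<and> fresh_samples M n D \<xi> \<and>
         (\<forall>i<n. prob_space (D i) \<and> (\<forall>z. integrable (D i) (loss z))) \<and>
         smooth_clients Lf n f \<and> bounded_variance \<sigma> n D f g \<and>
         bounded_heterogeneity \<zeta>x \<zeta>y n f \<and> PL_in_y \<mu> F \<and>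
         (\<forall>x. \<Phi> x0 - \<Phi> x \<le> \<Delta>\<Phi>) \<and> \<Phi> x0 - F (x0, y0) \<le> \<Delta>y)"

end

theory Submission
  imports Defs
begin

text \<open>
  With \<open>F\<close> the global function and \<open>\<Phi> = max_y F\<close>, all functions involved differ from their affine
  approximations by at most \<open>k * norm (z' - z) ^ 2\<close>. For \<open>\<Phi>\<close> this follows directly from the PL
  inequality, without quadratic growth: at a maximizer \<open>y*\<close> for \<open>x\<close> the gap \<open>\<Phi> x' - F (x', y*)\<close> is at
  most \<open>norm (grad_y F (x', y*)) ^ 2 / (2 * \<mu>)\<close>, which is quadratic in \<open>x' - x\<close>. The gap function
  \<open>(x, y) \<mapsto> \<Phi> x - F (x, y)\<close> is nonnegative, so the square of its gradient, hence the distance of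
  \<open>grad_x F (x, y)\<close> to the gradient of \<open>\<Phi>\<close>, is bounded by a multiple of the gap itself.

  Along the client averages, \<open>\<Phi> + gap / 6 + (\<eta>x + \<eta>y) * e\<close>, where \<open>e\<close> is the squared distance of the
  averaged momentum to the gradient of \<open>F\<close>, decreases in expectation by a multiple of
  \<open>a * norm (gradient \<Phi>) ^ 2\<close> up to errors of order \<open>a\<^sup>2 * \<sigma>\<^sup>2 / n\<close> (sampling) and \<open>a * (a * \<tau>)\<^sup>2\<close>
  (drift of the clients within a round). With \<open>q = (n * T) powr (1 / 4)\<close>, \<open>a\<close> of order \<open>n / q\<^sup>2\<close> and
  \<open>\<tau>\<close> of order \<open>q / n\<close>, the mean of the squared gradients is of order \<open>1 / q\<^sup>2\<close>, and the
  condition \<open>c * n ^ 3 \<le> T\<close> makes \<open>q / n\<close> bounded below, so that rounding \<open>\<tau>\<close> up is harmless.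
\<close>

section \<open>Functions with a quadratic bound\<close>

text \<open>Two-sided, so that it forces \<open>G\<close> to be the gradient of \<open>f\<close> and
  to be Lipschitz, and so that it passes to differences. It can thus be proved for
  \<open>\<Phi>\<close> and the gap before anything is known about their differentiability.\<close>

definition quad_bound :: "real \<Rightarrow> ('v::real_inner \<Rightarrow> real) \<Rightarrow> ('v \<Rightarrow> 'v) \<Rightarrow> bool" where
  "quad_bound k f G \<longleftrightarrow> (\<forall>z z'. \<bar>f z' - f z - G z \<bullet> (z' - z)\<bar> \<le> k * (norm (z' - z))\<^sup>2)"

lemma quad_boundD:
  "quad_bound k f G \<Longrightarrow> \<bar>f z' - f z - G z \<bullet> (z' - z)\<bar> \<le> k * (norm (z' - z))\<^sup>2"
  by (auto simp: quad_bound_def)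

lemma quad_bound_mono: "quad_bound k f G \<Longrightarrow> k \<le> k' \<Longrightarrow> quad_bound k' f G"
  unfolding quad_bound_def by (meson mult_right_mono order_trans zero_le_power2)

lemma GDERIV_gradient:
  assumes "f differentiable (at z)"
  shows "GDERIV f z :> gradient f z"
proof -
  obtain f' where f': "(f has_derivative f') (at z)"
    using assms by (auto simp: differentiable_def)
  interpret bounded_linear f' using f' by (rule has_derivative_bounded_linear)
  \<comment> \<open>Riesz representation: the vector of the functional \<open>f'\<close> is the
    value of its adjoint at 1.\<close>
  define D where "D = adjoint f' (1::real)"
  have "f' h = h \<bullet> D" for h
    using adjoint_works[OF linear_axioms, of h 1] by (simp add: D_def)
  then have "f' = (\<lambda>h. h \<bullet> D)" by (rule ext)
  then have "GDERIV f z :> D"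
    using f' by (simp add: gderiv_def)
  then show ?thesis by (simp add: gradient_eqI)
qed

text \<open>The mean value theorem on the segment from \<open>z\<close> to \<open>z'\<close>; it
  gives the constant \<open>L\<close> where integration would give \<open>L / 2\<close>.\<close>

lemma Lipschitz_gradient_quad_bound:
  assumes diff: "\<And>z. GDERIV f z :> G z"
    and lip: "\<And>z z'. norm (G z - G z') \<le> L * norm (z - z')" and L: "L \<ge> 0"
  shows "quad_bound L f G"
  unfolding quad_bound_def
proof (intro allI)
  fix z z'
  define \<phi> where "\<phi> = (\<lambda>s::real. f (z + s *\<^sub>R (z' - z)))"
  have "(\<phi> has_derivative (\<lambda>h. (h *\<^sub>R (z' - z)) \<bullet> G (z + s *\<^sub>R (z' - z)))) (at s within {0..1})" for s
    unfolding \<phi>_def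
    by (rule has_derivative_compose[where g=f])
      (auto intro!: derivative_eq_intros diff[unfolded gderiv_def])
  then obtain s where s: "s \<in> {0..1}"
    "\<phi> 1 - \<phi> 0 = ((1 - 0) *\<^sub>R (z' - z)) \<bullet> G (z + s *\<^sub>R (z' - z))"
    using mvt_very_simple[of 0 1 \<phi> "\<lambda>s h. (h *\<^sub>R (z' - z)) \<bullet> G (z + s *\<^sub>R (z' - z))"] by auto
  then have "f z' - f z - G z \<bullet> (z' - z) = (G (z + s *\<^sub>R (z' - z)) - G z) \<bullet> (z' - z)"
    by (simp add: \<phi>_def inner_diff_left inner_diff_right inner_commute)
  also have "\<bar>\<dots>\<bar> \<le> norm (G (z + s *\<^sub>R (z' - z)) - G z) * norm (z' - z)"
    by (rule Cauchy_Schwarz_ineq2)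
  also have "\<dots> \<le> (L * norm (z' - z)) * norm (z' - z)"
  proof (rule mult_right_mono)
    have "norm (G (z + s *\<^sub>R (z' - z)) - G z) \<le> L * norm (s *\<^sub>R (z' - z))"
      using lip[of "z + s *\<^sub>R (z' - z)" z] by simp
    also have "\<dots> \<le> L * norm (z' - z)"
      using s L by (intro mult_left_mono) (auto simp: mult_left_le_one_le)
    finally show "norm (G (z + s *\<^sub>R (z' - z)) - G z) \<le> L * norm (z' - z)" .
  qed simp
  finally show "\<bar>f z' - f z - G z \<bullet> (z' - z)\<bar> \<le> L * (norm (z' - z))\<^sup>2"
    by (simp add: power2_eq_square mult.assoc)
qed

lemma quad_bound_GDERIV:
  assumes q: "quad_bound k f G"
  shows "GDERIV f z :> G z"
  unfolding gderiv_def has_derivative_within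
proof
  show "bounded_linear (\<lambda>h. h \<bullet> G z)" by (rule bounded_linear_inner_left)
  show "((\<lambda>y. (1 / norm (y - z)) *\<^sub>R (f y - (f z + (y - z) \<bullet> G z))) \<longlongrightarrow> 0) (at z)"
  proof (rule tendsto_0_le[where K=1])
    show "((\<lambda>y. k * norm (y - z)) \<longlongrightarrow> 0) (at z)"
      by (rule tendsto_eq_intros refl | simp)+
    show "\<forall>\<^sub>F y in at z. norm ((1 / norm (y - z)) *\<^sub>R (f y - (f z + (y - z) \<bullet> G z)))
        \<le> norm (k * norm (y - z)) * 1"
      unfolding eventually_at_filter
    proof (intro always_eventually allI impI)
      fix y assume "y \<noteq> z"
      then have "norm ((1 / norm (y - z)) *\<^sub>R (f y - (f z + (y - z) \<bullet> G z)))
          = \<bar>f y - f z - G z \<bullet> (y - z)\<bar> / norm (y - z)"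
        by (simp add: inner_commute[of "G z"] diff_diff_add)
      also have "\<dots> \<le> k * (norm (y - z))\<^sup>2 / norm (y - z)"
        by (intro divide_right_mono quad_boundD q) auto
      also have "\<dots> = k * norm (y - z)" using \<open>y \<noteq> z\<close> by (simp add: power2_eq_square)
      finally show "norm ((1 / norm (y - z)) *\<^sub>R (f y - (f z + (y - z) \<bullet> G z)))
          \<le> norm (k * norm (y - z)) * 1" by simp
    qed
  qed
qed

section \<open>Weighted inequalities for squared norms\<close>

lemma norm_add_sq_le:
  fixes u v :: "'v::real_inner"
  assumes "s > 0"
  shows "(norm (u + v))\<^sup>2 \<le> (1 + s) * (norm u)\<^sup>2 + (1 + 1 / s) * (norm v)\<^sup>2"
proof -
  define r where "r = sqrt s"
  have r: "r > 0" "s = r * r" using assms by (auto simp: r_def)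
  have "0 \<le> (norm (r *\<^sub>R u - (1 / r) *\<^sub>R v))\<^sup>2" by simp
  also have "\<dots> = s * (norm u)\<^sup>2 + (1 / s) * (norm v)\<^sup>2 - 2 * (u \<bullet> v)"
    using r(1) by (simp add: power2_norm_eq_inner inner_diff_left inner_diff_right inner_commute r(2))
  finally show ?thesis
    by (simp add: power2_norm_eq_inner inner_add_left inner_add_right inner_commute distrib_right)
qed

lemma norm_add_sq_le2:
  fixes u v :: "'v::real_inner"
  shows "(norm (u + v))\<^sup>2 \<le> 2 * (norm u)\<^sup>2 + 2 * (norm v)\<^sup>2"
  using norm_add_sq_le[of 1 u v] by simp

lemma norm_add_sq_le3:
  fixes u v w :: "'v::real_inner"
  shows "(norm (u + v + w))\<^sup>2 \<le> 3 * (norm u)\<^sup>2 + 3 * (norm v)\<^sup>2 + 3 * (norm w)\<^sup>2"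
  using norm_add_sq_le[of "1/2" "u + v" w] norm_add_sq_le2[of u v] by simp

lemma norm_convex_sq_le:
  fixes u v :: "'v::real_inner"
  assumes "0 \<le> b" "b \<le> 1"
  shows "(norm ((1 - b) *\<^sub>R u + b *\<^sub>R v))\<^sup>2 \<le> (1 - b) * (norm u)\<^sup>2 + b * (norm v)\<^sup>2"
proof -
  have "(1 - b) * (norm u)\<^sup>2 + b * (norm v)\<^sup>2 - (norm ((1 - b) *\<^sub>R u + b *\<^sub>R v))\<^sup>2
      = b * (1 - b) * (norm (u - v))\<^sup>2"
    by (simp add: power2_norm_eq_inner inner_add_left inner_add_right inner_diff_left
        inner_diff_right inner_commute algebra_simps)
  also have "\<dots> \<ge> 0" using assms by simp
  finally show ?thesis by simp
qed

text \<open>The affine minorants at \<open>z\<close> and \<open>z'\<close>, compared at \<open>z' + u\<close> with \<open>u\<close> a multiple of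
  \<open>G z' - G z\<close>, control the change of \<open>G\<close>.\<close>

lemma quad_bound_Lipschitz:
  assumes q: "quad_bound k f G" and k: "k > 0"
  shows "norm (G z' - G z) \<le> 6 * k * norm (z' - z)"
proof -
  define w where "w = G z' - G z"
  define v where "v = z' - z"
  \<comment> \<open>With this factor \<open>w \<bullet> u\<close> equals
    \<open>norm w ^ 2 / (6 * k)\<close>, which is twice \<open>3 * k * norm u ^ 2\<close>; the
    remaining half is bounded by \<open>3 * k * norm v ^ 2\<close>.\<close>
  define u where "u = (1 / (6 * k)) *\<^sub>R w"
  have a: "f (z' + u) - f z - G z \<bullet> (v + u) \<le> k * (norm (v + u))\<^sup>2"
    using quad_boundD[OF q, of "z' + u" z] by (simp add: v_def algebra_simps)
  have b: "- (k * (norm u)\<^sup>2) \<le> f (z' + u) - f z' - G z' \<bullet> u"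
    using quad_boundD[OF q, of "z' + u" z'] by simp
  have c: "- (k * (norm v)\<^sup>2) \<le> f z' - f z - G z \<bullet> v"
    using quad_boundD[OF q, of z' z] by (simp add: v_def)
  have d: "k * (norm (v + u))\<^sup>2 \<le> k * (2 * (norm v)\<^sup>2 + 2 * (norm u)\<^sup>2)"
    using k by (intro mult_left_mono norm_add_sq_le2) auto
  have "w \<bullet> u \<le> k * (3 * (norm u)\<^sup>2 + 3 * (norm v)\<^sup>2)"
    using a b c d by (simp add: w_def inner_diff_left inner_add_right algebra_simps)
  moreover have "w \<bullet> u = (norm w)\<^sup>2 / (6 * k)"
    by (simp add: u_def power2_norm_eq_inner)
  moreover have "(norm u)\<^sup>2 = (norm w)\<^sup>2 / (36 * k\<^sup>2)"
    by (simp add: u_def power_mult_distrib power_divide)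
  ultimately have "(norm w)\<^sup>2 / (6 * k) \<le> k * (3 * ((norm w)\<^sup>2 / (36 * k\<^sup>2)) + 3 * (norm v)\<^sup>2)"
    by simp
  then have "(norm w)\<^sup>2 \<le> (6 * k * norm v)\<^sup>2"
    using k by (simp add: field_simps power2_eq_square)
  then show ?thesis
    using k power2_le_imp_le[of "norm w" "6 * k * norm v"] by (simp add: w_def v_def)
qed

lemma quad_bound_continuous:
  fixes G :: "'v::real_inner \<Rightarrow> 'v"
  assumes q: "quad_bound k f G" and k: "k > 0"
  shows "continuous_on UNIV f" "continuous_on UNIV G"
proof -
  show "continuous_on UNIV f"
    using quad_bound_GDERIV[OF q]
    by (intro continuous_at_imp_continuous_on ballI) (auto simp: gderiv_def intro: has_derivative_continuous)
  have "(6 * k)-lipschitz_on UNIV G"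
    using quad_bound_Lipschitz[OF q k] k by (auto simp: lipschitz_on_def dist_norm)
  then show "continuous_on UNIV G" by (rule lipschitz_on_continuous_on)
qed

text \<open>A gradient step with step size \<open>1 / (2 * k)\<close> lowers \<open>h\<close> by at
  least \<open>norm (W z) ^ 2 / (4 * k)\<close> and cannot lead below zero.\<close>

lemma nonneg_gradient_sq_le:
  assumes q: "quad_bound k h W" and k: "k > 0" and nonneg: "\<And>z. h z \<ge> 0"
  shows "(norm (W z))\<^sup>2 \<le> 4 * k * h z"
proof -
  define u where "u = - (1 / (2 * k)) *\<^sub>R W z"
  have "0 \<le> h (z + u)" by (rule nonneg)
  also have "\<dots> \<le> h z + W z \<bullet> u + k * (norm u)\<^sup>2"
    using quad_boundD[OF q, of "z + u" z] by simp
  also have "\<dots> = h z - (norm (W z))\<^sup>2 / (4 * k)"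
    using k by (simp add: u_def field_simps flip: power2_norm_eq_inner) (simp add: power2_eq_square)
  finally show ?thesis using k by (simp add: field_simps)
qed

section \<open>The maximum over y and the gap function\<close>

lemma max_y_eqI:
  assumes "\<And>y. f (x, y) \<le> f (x, ym)"
  shows "max_y f x = f (x, ym)"
  unfolding max_y_def using assms by (intro cSup_eq_maximum) auto

lemma norm_Pair_sq: "(norm (x, y))\<^sup>2 = (norm x)\<^sup>2 + (norm y)\<^sup>2"
  by (simp add: norm_Pair)

lemma norm_sq_fst_snd: "(norm z)\<^sup>2 = (norm (fst z))\<^sup>2 + (norm (snd z))\<^sup>2"
  by (metis norm_Pair_sq prod.collapse)

definition gap :: "('a \<times> 'b \<Rightarrow> real) \<Rightarrow> 'a \<times> 'b \<Rightarrow> real" where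
  "gap F z = max_y F (fst z) - F z"

definition gap_gradient :: 
  "('a::euclidean_space \<times> 'b::euclidean_space \<Rightarrow> real) \<Rightarrow> 'a \<times> 'b \<Rightarrow> 'a \<times> 'b" where
  "gap_gradient F z = (gradient (max_y F) (fst z), 0) - gradient F z"

text \<open>The maximizer supplied by \<open>PL_in_y\<close> makes the supremum in
  \<open>max_y\<close> an attained maximum, hence a genuine upper bound.\<close>

lemma gap_nonneg:
  assumes "PL_in_y \<mu> F" shows "gap F z \<ge> 0"
proof -
  obtain x y where z: "z = (x, y)" by (cases z)
  obtain ym where "\<And>y. F (x, y) \<le> F (x, ym)"
    using assms unfolding PL_in_y_def by meson
  with max_y_eqI[of F x ym] show ?thesis by (simp add: gap_def z)
qed

text \<open>At a maximizer \<open>ym\<close> for \<open>x\<close> the partial gradient in \<open>y\<close> vanishes, so at \<open>(x', ym)\<close> it is at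
  most \<open>L * norm (x' - x)\<close>, and the PL inequality makes the gap there quadratically small.\<close>

lemma max_y_quad_bound:
  fixes F :: "'a::euclidean_space \<times> 'b::euclidean_space \<Rightarrow> real"
  assumes diff: "\<And>z. GDERIV F z :> gradient F z"
    and lip: "\<And>z z'. norm (gradient F z - gradient F z') \<le> L * norm (z - z')"
    and L: "L > 0" and \<mu>: "\<mu> > 0" and PL: "PL_in_y \<mu> F"
  shows "quad_bound (L + L\<^sup>2 / (2 * \<mu>)) (max_y F) (gradient (max_y F))"
proof -
  have qF: "quad_bound L F (gradient F)"
    using Lipschitz_gradient_quad_bound[OF diff lip] L by simp
  have "\<forall>x. \<exists>ym. \<forall>y. F (x, y) \<le> F (x, ym)"
    using PL unfolding PL_in_y_def by blast
  then obtain ys where ys: "F (x, y) \<le> F (x, ys x)" for x y by metis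
  have \<Phi>: "max_y F x = F (x, ys x)" for x
    using ys by (intro max_y_eqI)
  have \<Phi>_ge: "F (x, y) \<le> max_y F x" for x y
    using ys by (simp add: \<Phi>)
  have gy0: "grad_y F (x, ys x) = 0" for x
  proof -
    define D where "D = gradient F (x, ys x)"
    have "((\<lambda>y. F (x, y)) has_derivative (\<lambda>h. (0, h) \<bullet> D)) (at (ys x))"
      by (rule has_derivative_compose[where g=F])
        (auto intro!: derivative_eq_intros diff[unfolded gderiv_def] simp: D_def)
    then have "(\<lambda>h. (0, h) \<bullet> D) = (\<lambda>h. 0)"
      by (rule has_derivative_local_max) (use ys in \<open>auto intro!: always_eventually\<close>)
    then have "(0::'a, snd D) \<bullet> D = 0" by metis
    then show ?thesis by (simp add: grad_y_def D_def inner_prod_def)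
  qed
  \<comment> \<open>Danskin's formula: the candidate gradient is the partial gradient in
    \<open>x\<close> at the selected maximizer. The quadratic bound then identifies it with
    \<open>gradient (max_y F)\<close>.\<close>
  define g where "g = (\<lambda>x. grad_x F (x, ys x))"
  have ip: "gradient F (x, ys x) \<bullet> ((x', ys x) - (x, ys x)) = g x \<bullet> (x' - x)" for x x'
    by (simp add: g_def grad_x_def inner_prod_def)
  have "quad_bound (L + L\<^sup>2 / (2 * \<mu>)) (max_y F) g"
    unfolding quad_bound_def
  proof (intro allI)
    fix x x'
    \<comment> \<open>The increment of \<open>max_y F\<close> is split at
      \<open>F (x', ys x)\<close>: fact \<open>1\<close> treats the change of \<open>x\<close> with
      the maximizer frozen, fact \<open>2\<close> the remaining gap at \<open>x'\<close>, which lies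
      between zero and the PL estimate.\<close>
    have 1: "\<bar>F (x', ys x) - F (x, ys x) - g x \<bullet> (x' - x)\<bar> \<le> L * (norm (x' - x))\<^sup>2"
      using quad_boundD[OF qF, of "(x', ys x)" "(x, ys x)"] by (simp only: ip) (simp add: norm_Pair)
    have "2 * \<mu> * (max_y F x' - F (x', ys x)) \<le> (norm (grad_y F (x', ys x)))\<^sup>2"
      using PL unfolding PL_in_y_def by blast
    also have "\<dots> \<le> (L * norm (x' - x))\<^sup>2"
    proof (rule power_mono)
      have "norm (grad_y F (x', ys x)) = norm (snd (gradient F (x', ys x) - gradient F (x, ys x)))"
        using gy0[of x] by (simp add: grad_y_def)
      also have "\<dots> \<le> norm (gradient F (x', ys x) - gradient F (x, ys x))"
        by (metis norm_snd_le prod.collapse)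
      also have "\<dots> \<le> L * norm ((x', ys x) - (x, ys x))" by (rule lip)
      finally show "norm (grad_y F (x', ys x)) \<le> L * norm (x' - x)" by (simp add: norm_Pair)
    qed simp
    finally have 2: "max_y F x' - F (x', ys x) \<le> L\<^sup>2 / (2 * \<mu>) * (norm (x' - x))\<^sup>2"
      using \<mu> by (simp add: field_simps power_mult_distrib)
    have "0 \<le> L\<^sup>2 / (2 * \<mu>) * (norm (x' - x))\<^sup>2" using \<mu> by simp
    then show "\<bar>max_y F x' - max_y F x - g x \<bullet> (x' - x)\<bar> \<le> (L + L\<^sup>2 / (2 * \<mu>)) * (norm (x' - x))\<^sup>2"
      using 1 2 \<Phi>_ge[of x' "ys x"] unfolding \<Phi>[of x] distrib_right abs_le_iff by linarith
  qed
  moreover from this have "gradient (max_y F) = g"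
    by (intro ext gradient_eqI quad_bound_GDERIV)
  ultimately show ?thesis by simp
qed

lemma gap_quad_bound:
  fixes F :: "'a::euclidean_space \<times> 'b::euclidean_space \<Rightarrow> real"
  assumes q1: "quad_bound k1 (max_y F) (gradient (max_y F))" and q2: "quad_bound k2 F (gradient F)"
    and k1: "k1 \<ge> 0"
  shows "quad_bound (k1 + k2) (gap F) (gap_gradient F)"
  unfolding quad_bound_def
proof (intro allI)
  fix z z' :: "'a \<times> 'b"
  have 1: "\<bar>max_y F (fst z') - max_y F (fst z) - gradient (max_y F) (fst z) \<bullet> (fst z' - fst z)\<bar>
      \<le> k1 * (norm (z' - z))\<^sup>2"
  proof (rule order_trans[OF quad_boundD[OF q1]])
    show "k1 * (norm (fst z' - fst z))\<^sup>2 \<le> k1 * (norm (z' - z))\<^sup>2"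
      using k1 by (intro mult_left_mono) (auto simp: norm_sq_fst_snd[of "z' - z"])
  qed
  have 2: "\<bar>F z' - F z - gradient F z \<bullet> (z' - z)\<bar> \<le> k2 * (norm (z' - z))\<^sup>2"
    by (rule quad_boundD[OF q2])
  have "gap_gradient F z \<bullet> (z' - z) =
      gradient (max_y F) (fst z) \<bullet> (fst z' - fst z) - gradient F z \<bullet> (z' - z)"
    by (simp add: gap_gradient_def inner_diff_left) (simp add: inner_prod_def)
  then show "\<bar>gap F z' - gap F z - gap_gradient F z \<bullet> (z' - z)\<bar> \<le> (k1 + k2) * (norm (z' - z))\<^sup>2"
    using 1 2 by (simp add: gap_def distrib_right)
qed

section \<open>Fresh samples and stochastic gradients\<close>

lemma avg_add: "avg n (\<lambda>i. u i + v i) = avg n u + avg n v"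
  by (simp add: avg_def sum.distrib scaleR_add_right)

lemma avg_diff: "avg n (\<lambda>i. u i - v i) = avg n u - avg n v"
  by (simp add: avg_def sum_subtractf scaleR_diff_right)

lemma avg_scaleR: "avg n (\<lambda>i. r *\<^sub>R v i) = r *\<^sub>R avg n v"
  by (simp add: avg_def scaleR_sum_right mult.commute)

lemma avg_mult: "avg n (\<lambda>i. r * v i) = r * avg n (v :: nat \<Rightarrow> real)"
  using avg_scaleR[of n r v] by simp

lemma avg_const: "n \<ge> 1 \<Longrightarrow> avg n (\<lambda>i. v) = v"
  by (simp add: avg_def sum_constant_scaleR)

lemma avg_cong: "(\<And>i. i < n \<Longrightarrow> u i = v i) \<Longrightarrow> avg n u = avg n v"
  by (simp add: avg_def)

lemma avg_mono: "(\<And>i. i < n \<Longrightarrow> u i \<le> v i) \<Longrightarrow> avg n u \<le> (avg n v :: real)"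
  by (auto simp: avg_def intro!: divide_right_mono sum_mono)

lemma avg_le_const: "n \<ge> 1 \<Longrightarrow> (\<And>i. i < n \<Longrightarrow> u i \<le> c) \<Longrightarrow> avg n u \<le> (c :: real)"
  using avg_mono[of n u "\<lambda>_. c"] by (simp add: avg_const)

lemma avg_nonneg: "(\<And>i. i < n \<Longrightarrow> 0 \<le> v i) \<Longrightarrow> 0 \<le> (avg n v :: real)"
  by (auto simp: avg_def intro!: divide_nonneg_nonneg sum_nonneg)

lemma avg_linear: "linear h \<Longrightarrow> avg n (\<lambda>i. h (v i)) = h (avg n v)"
  by (simp add: avg_def linear_scale linear_sum)

lemma avg_inner: "avg n (\<lambda>i. v i \<bullet> c) = avg n v \<bullet> c"
  by (simp add: avg_def inner_sum_left sum_divide_distrib)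

lemma avg_Pair: "avg n (\<lambda>i. (u i, v i)) = (avg n u, avg n v)"
  by (simp add: avg_def prod_eq_iff fst_sum snd_sum)

lemma avg_norm_diff_sq:
  fixes v :: "nat \<Rightarrow> 'v::real_inner"
  assumes "n \<ge> 1"
  shows "avg n (\<lambda>i. (norm (v i - c))\<^sup>2) =
    avg n (\<lambda>i. (norm (v i))\<^sup>2) - 2 * (avg n v \<bullet> c) + (norm c)\<^sup>2"
proof -
  have "(\<lambda>i. (norm (v i - c))\<^sup>2) = (\<lambda>i. ((norm (v i))\<^sup>2 - 2 * (v i \<bullet> c)) + (norm c)\<^sup>2)"
    by (simp add: fun_eq_iff power2_norm_eq_inner inner_diff_left inner_diff_right inner_commute)
  then show ?thesis
    by (simp only: avg_add avg_diff avg_mult avg_inner avg_const[OF assms])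
qed

text \<open>The two sides differ by exactly \<open>norm (avg n v - c) ^ 2\<close>.\<close>

lemma avg_deviation_le:
  fixes v :: "nat \<Rightarrow> 'v::real_inner"
  assumes "n \<ge> 1"
  shows "avg n (\<lambda>i. (norm (v i - avg n v))\<^sup>2) \<le> avg n (\<lambda>i. (norm (v i - c))\<^sup>2)"
proof -
  have "avg n (\<lambda>i. (norm (v i - c))\<^sup>2) - avg n (\<lambda>i. (norm (v i - avg n v))\<^sup>2)
      = (norm (avg n v - c))\<^sup>2"
    unfolding avg_norm_diff_sq[OF assms]
    by (simp add: power2_norm_eq_inner inner_diff_left inner_diff_right inner_commute)
  then show ?thesis using zero_le_power2[of "norm (avg n v - c)"] by linarith
qed

text \<open>The variance around the mean is nonnegative.\<close>

lemma norm_avg_sq_le: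
  fixes v :: "nat \<Rightarrow> 'v::real_inner"
  assumes "n \<ge> 1"
  shows "(norm (avg n v))\<^sup>2 \<le> avg n (\<lambda>i. (norm (v i))\<^sup>2)"
proof -
  have "0 \<le> avg n (\<lambda>i. (norm (v i - avg n v))\<^sup>2)" by (intro avg_nonneg) simp
  then show ?thesis
    unfolding avg_norm_diff_sq[OF assms] by (simp add: power2_norm_eq_inner)
qed

section \<open>Square-integrable random vectors\<close>

definition sq_int :: "'w measure \<Rightarrow> ('w \<Rightarrow> 'v::euclidean_space) \<Rightarrow> bool" where
  "sq_int M X \<longleftrightarrow> X \<in> borel_measurable M \<and> integrable M (\<lambda>\<omega>. (norm (X \<omega>))\<^sup>2)"

lemma sq_int_measurable [measurable_dest]: "sq_int M X \<Longrightarrow> X \<in> borel_measurable M"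
  by (simp add: sq_int_def)

lemma sq_int_integrable: "sq_int M X \<Longrightarrow> integrable M (\<lambda>\<omega>. (norm (X \<omega>))\<^sup>2)"
  by (simp add: sq_int_def)

lemma sq_int_bound:
  assumes "sq_int M X" "integrable M C" "Y \<in> borel_measurable M"
    and "\<And>\<omega>. (norm (Y \<omega>))\<^sup>2 \<le> A * (norm (X \<omega>))\<^sup>2 + C \<omega>"
  shows "sq_int M Y"
  unfolding sq_int_def
proof
  have "integrable M (\<lambda>\<omega>. A * (norm (X \<omega>))\<^sup>2 + C \<omega>)"
    using assms by (auto simp: sq_int_def)
  then show "integrable M (\<lambda>\<omega>. (norm (Y \<omega>))\<^sup>2)"
  proof (rule Bochner_Integration.integrable_bound)
    show "AE \<omega> in M. norm ((norm (Y \<omega>))\<^sup>2) \<le> norm (A * (norm (X \<omega>))\<^sup>2 + C \<omega>)"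
      using assms(4) by (auto intro!: AE_I2 order_trans[OF assms(4)])
  qed (use assms in measurable)
qed (use assms in simp)

lemma sq_int_add: "sq_int M X \<Longrightarrow> sq_int M Y \<Longrightarrow> sq_int M (\<lambda>\<omega>. X \<omega> + Y \<omega>)"
  by (rule sq_int_bound[where X=X and A=2 and C="\<lambda>\<omega>. 2 * (norm (Y \<omega>))\<^sup>2"])
    (auto simp: sq_int_def norm_add_sq_le2)

lemma sq_int_scaleR: "sq_int M X \<Longrightarrow> sq_int M (\<lambda>\<omega>. r *\<^sub>R X \<omega>)"
  by (auto simp: sq_int_def power_mult_distrib)

lemma sq_int_diff: "sq_int M X \<Longrightarrow> sq_int M Y \<Longrightarrow> sq_int M (\<lambda>\<omega>. X \<omega> - Y \<omega>)"
  using sq_int_add[of M X "\<lambda>\<omega>. (-1) *\<^sub>R Y \<omega>"] sq_int_scaleR[of M Y "-1"] by simp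

lemma sq_int_linear:
  assumes "sq_int M X" "bounded_linear h"
  shows "sq_int M (\<lambda>\<omega>. h (X \<omega>))"
proof -
  obtain K where K: "norm (h x) \<le> norm x * K" for x
    using bounded_linear.bounded[OF assms(2)] by blast
  note [measurable] = borel_measurable_continuous_onI[OF linear_continuous_on[OF assms(2)]]
    sq_int_measurable[OF assms(1)]
  show ?thesis
  proof (rule sq_int_bound[where X=X and A="K\<^sup>2" and C="\<lambda>_. 0"])
    show "(norm (h (X \<omega>)))\<^sup>2 \<le> K\<^sup>2 * (norm (X \<omega>))\<^sup>2 + 0" for \<omega>
      using power_mono[OF K[of "X \<omega>"], of 2] by (simp add: power_mult_distrib mult.commute)
  qed (use assms in auto)
qed

lemma (in finite_measure) sq_int_const: "sq_int M (\<lambda>\<omega>. c)"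
  by (simp add: sq_int_def)

lemma (in finite_measure) sq_int_avg:
  assumes "\<And>i. i < n \<Longrightarrow> sq_int M (X i)"
  shows "sq_int M (\<lambda>\<omega>. avg n (\<lambda>i. X i \<omega>))"
proof -
  have "sq_int M (\<lambda>\<omega>. \<Sum>i<m. X i \<omega>)" if "m \<le> n" for m
    using that by (induction m) (auto intro!: sq_int_const sq_int_add assms)
  then show ?thesis unfolding avg_def by (intro sq_int_scaleR) simp
qed

lemma (in finite_measure) sq_int_Lipschitz:
  assumes X: "sq_int M X" and h: "\<And>x y. norm (h x - h y) \<le> L * norm (x - y)"
  shows "sq_int M (\<lambda>\<omega>. h (X \<omega>))"
proof -
  have "norm (h x - h y) \<le> \<bar>L\<bar> * norm (x - y)" for x y
    using h[of x y] mult_right_mono[OF abs_ge_self[of L], of "norm (x - y)"] by simp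
  then have "\<bar>L\<bar>-lipschitz_on UNIV h"
    by (simp add: lipschitz_on_def dist_norm)
  then have [measurable]: "h \<in> borel_measurable borel"
    by (intro borel_measurable_continuous_onI lipschitz_on_continuous_on)
  have "sq_int M (\<lambda>\<omega>. h (X \<omega>) - h 0)"
  proof (rule sq_int_bound[where X=X and A="L\<^sup>2" and C="\<lambda>_. 0"])
    show "(norm (h (X \<omega>) - h 0))\<^sup>2 \<le> L\<^sup>2 * (norm (X \<omega>))\<^sup>2 + 0" for \<omega>
      using power_mono[OF h[of "X \<omega>" 0], of 2] by (simp add: power_mult_distrib)
  qed (use X in auto)
  from sq_int_add[OF this sq_int_const[of "h 0"]] show ?thesis by simp
qed

lemma sq_int_inner:
  assumes "sq_int M X" "sq_int M Y"
  shows "integrable M (\<lambda>\<omega>. X \<omega> \<bullet> Y \<omega>)"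
proof (rule Bochner_Integration.integrable_bound)
  show "integrable M (\<lambda>\<omega>. (norm (X \<omega>))\<^sup>2 + (norm (Y \<omega>))\<^sup>2)"
    using assms by (auto simp: sq_int_def)
  have "\<bar>x \<bullet> y\<bar> \<le> (norm x)\<^sup>2 + (norm y)\<^sup>2" for x y :: 'b
  proof -
    have "2 * norm x * norm y \<le> (norm x)\<^sup>2 + (norm y)\<^sup>2" by (rule sum_squares_bound)
    moreover have "0 \<le> norm x * norm y" by simp
    ultimately show ?thesis using Cauchy_Schwarz_ineq2[of x y] by linarith
  qed
  then show "AE \<omega> in M. norm (X \<omega> \<bullet> Y \<omega>) \<le> norm ((norm (X \<omega>))\<^sup>2 + (norm (Y \<omega>))\<^sup>2)"
    by simp
qed (use assms in measurable)

text \<open>After subtraction of the affine approximation at 0 the rest is at most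
  \<open>k * norm X ^ 2\<close> in absolute value, and the affine part is integrable because
  \<open>X\<close> is.\<close>

lemma (in finite_measure) quad_bound_integrable:
  assumes q: "quad_bound k h W" and k: "k > 0" and X: "sq_int M X"
  shows "integrable M (\<lambda>\<omega>. h (X \<omega>))"
proof -
  note [measurable] = borel_measurable_continuous_onI[OF quad_bound_continuous(1)[OF q k]]
    sq_int_measurable[OF X]
  have "integrable M (\<lambda>\<omega>. h (X \<omega>) - h 0 - W 0 \<bullet> X \<omega>)"
  proof (rule Bochner_Integration.integrable_bound)
    show "integrable M (\<lambda>\<omega>. k * (norm (X \<omega>))\<^sup>2)" using X by (auto simp: sq_int_def)
    show "AE \<omega> in M. norm (h (X \<omega>) - h 0 - W 0 \<bullet> X \<omega>) \<le> norm (k * (norm (X \<omega>))\<^sup>2)"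
      using quad_boundD[OF q, of _ 0] k by auto
  qed measurable
  moreover have "integrable M (\<lambda>\<omega>. h 0 + W 0 \<bullet> X \<omega>)"
    by (intro Bochner_Integration.integrable_add sq_int_inner sq_int_const X) simp
  ultimately have "integrable M (\<lambda>\<omega>. (h (X \<omega>) - h 0 - W 0 \<bullet> X \<omega>) + (h 0 + W 0 \<bullet> X \<omega>))"
    by (rule Bochner_Integration.integrable_add)
  then show ?thesis by simp
qed

lemma bounded_varianceD:
  assumes "bounded_variance \<sigma> n D f g" "i < n"
  shows "(\<lambda>(z, s). g i z s) \<in> borel_measurable (borel \<Otimes>\<^sub>M D i)"
    and "integrable (D i) (g i z)" "(\<integral>s. g i z s \<partial>D i) = gradient (f i) z"
    and "integrable (D i) (\<lambda>s. (norm (g i z s - gradient (f i) z))\<^sup>2)"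
    and "(\<integral>s. (norm (g i z s - gradient (f i) z))\<^sup>2 \<partial>D i) \<le> \<sigma>\<^sup>2"
  using assms unfolding bounded_variance_def by blast+

section \<open>Histories of samples and independence of a fresh one\<close>

locale fresh_sampling = prob_space M
  for M :: "'w measure" +
  fixes n :: nat and D :: "nat \<Rightarrow> 's measure" and \<xi> :: "nat \<Rightarrow> nat \<Rightarrow> 'w \<Rightarrow> 's"
  assumes fresh: "fresh_samples M n D \<xi>"
    and D_prob: "\<And>i. i < n \<Longrightarrow> prob_space (D i)"
begin

text \<open>The sigma-algebra generated by the samples with index in \<open>A\<close>. Arbitrary
  sets of pairs (client, time), rather than times alone, allow the samples of one time to be
  revealed client by client.\<close>

definition hist :: "(nat \<times> nat) set \<Rightarrow> 'w measure" where
  "hist A = vimage_algebra (space M) (\<lambda>\<omega>. \<lambda>p\<in>A. \<xi> (fst p) (snd p) \<omega>) (\<Pi>\<^sub>M p\<in>A. D (fst p))"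

lemma space_hist [simp]: "space (hist A) = space M"
  by (simp add: hist_def)

lemma sample_measurable [measurable]: "i < n \<Longrightarrow> \<xi> i t \<in> measurable M (D i)"
  using fresh by (auto simp: fresh_samples_def indep_vars_def)

lemma distr_sample: "i < n \<Longrightarrow> distr M (D i) (\<xi> i t) = D i"
  using fresh by (auto simp: fresh_samples_def)

lemma samples_measurable:
  "A \<subseteq> {..<n} \<times> UNIV \<Longrightarrow>
    (\<lambda>\<omega>. \<lambda>p\<in>A. \<xi> (fst p) (snd p) \<omega>) \<in> measurable M (\<Pi>\<^sub>M p\<in>A. D (fst p))"
  by (rule measurable_restrict) (auto intro: sample_measurable)

lemma samples_measurable_hist:
  assumes "A \<subseteq> {..<n} \<times> UNIV"
  shows "(\<lambda>\<omega>. \<lambda>p\<in>A. \<xi> (fst p) (snd p) \<omega>) \<in> measurable (hist A) (\<Pi>\<^sub>M p\<in>A. D (fst p))"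
  unfolding hist_def
  using measurable_space[OF samples_measurable[OF assms]]
  by (intro measurable_vimage_algebra1) auto

lemma sample_measurable_hist:
  assumes "A \<subseteq> {..<n} \<times> UNIV" "(i, t) \<in> A"
  shows "\<xi> i t \<in> measurable (hist A) (D i)"
proof -
  have "(\<lambda>\<omega>. (\<lambda>p\<in>A. \<xi> (fst p) (snd p) \<omega>) (i, t)) \<in> measurable (hist A) (D (fst (i, t)))"
    by (rule measurable_compose[OF samples_measurable_hist[OF assms(1)]
        measurable_component_singleton[OF assms(2)]])
  then show ?thesis using assms(2) by simp
qed

lemma measurable_hist_mono:
  assumes "X \<in> measurable (hist A) N" "A \<subseteq> B" "B \<subseteq> {..<n} \<times> UNIV"
  shows "X \<in> measurable (hist B) N"
proof -
  have A: "A \<subseteq> {..<n} \<times> UNIV" using assms by auto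
  have "(\<lambda>\<omega>. \<lambda>p\<in>A. \<xi> (fst p) (snd p) \<omega>) \<in> measurable (hist B) (\<Pi>\<^sub>M p\<in>A. D (fst p))"
    by (rule measurable_restrict) (use assms(2,3) in \<open>auto intro!: sample_measurable_hist\<close>)
  then have "(\<lambda>\<omega>. \<omega>) \<in> measurable (hist B) (hist A)"
    unfolding hist_def[of A] by (intro measurable_vimage_algebra2) auto
  from measurable_compose[OF this assms(1)] show ?thesis by simp
qed

lemma measurable_hist_imp:
  assumes "X \<in> measurable (hist A) N" "A \<subseteq> {..<n} \<times> UNIV"
  shows "X \<in> measurable M N"
proof -
  have "(\<lambda>\<omega>. \<omega>) \<in> measurable M (hist A)"
    unfolding hist_def using samples_measurable[OF assms(2)]
    by (intro measurable_vimage_algebra2) auto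
  from measurable_compose[OF this assms(1)] show ?thesis by simp
qed

text \<open>This takes the place of conditional expectations: once the joint law is a product,
  Fubini lets \<open>X\<close> be frozen while the fresh sample is integrated out. Equality of the
  two measures is checked on rectangles.\<close>

lemma distr_hist_sample:
  assumes X: "X \<in> measurable (hist A) N" and A: "A \<subseteq> {..<n} \<times> UNIV"
    and i: "i < n" "(i, t) \<notin> A"
  shows "distr M (N \<Otimes>\<^sub>M D i) (\<lambda>\<omega>. (X \<omega>, \<xi> i t \<omega>)) = distr M N X \<Otimes>\<^sub>M D i"
proof -
  let ?W = "\<lambda>\<omega>. \<lambda>p\<in>A. \<xi> (fst p) (snd p) \<omega>" and ?P = "\<Pi>\<^sub>M p\<in>A. D (fst p)"
    and ?V = "\<lambda>\<omega>. \<lambda>p\<in>{(i, t)}. \<xi> (fst p) (snd p) \<omega>" and ?Q = "\<Pi>\<^sub>M p\<in>{(i, t)}. D (fst p)"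
  have "indep_vars (\<lambda>p. D (fst p)) (\<lambda>p. \<xi> (fst p) (snd p)) ({..<n} \<times> UNIV)"
    using fresh by (simp add: fresh_samples_def case_prod_beta')
  from indep_var_restrict[OF this, of A "{(i, t)}"]
  have ind: "indep_var ?P ?W ?Q ?V"
    using A i by auto
  have eval: "(\<lambda>v. v (i, t)) \<in> measurable ?Q (D i)"
    using measurable_component_singleton[of "(i, t)" "{(i, t)}" "\<lambda>p. D (fst p)"] by simp
  note [measurable] = measurable_hist_imp[OF X A] sample_measurable[OF i(1)]
  interpret PX: prob_space "distr M N X" by (rule prob_space_distr) measurable
  interpret Di: prob_space "D i" by (rule D_prob[OF i(1)])
  show ?thesis
  proof (rule pair_measure_eqI[symmetric])
    show "sigma_finite_measure (distr M N X)" "sigma_finite_measure (D i)" by unfold_locales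
    show "sets (distr M N X \<Otimes>\<^sub>M D i) = sets (distr M (N \<Otimes>\<^sub>M D i) (\<lambda>\<omega>. (X \<omega>, \<xi> i t \<omega>)))"
      by (simp cong: sets_pair_measure_cong)
    fix B C assume B: "B \<in> sets (distr M N X)" and C: "C \<in> sets (D i)"
    then have B': "B \<in> sets N" by simp
    have "X -` B \<inter> space M \<in> sets (hist A)"
      using measurable_sets[OF X B'] by simp
    \<comment> \<open>An event of \<open>hist A\<close> is the preimage of an event of the sample
      vector over \<open>A\<close>, so the independence of disjoint blocks of samples
      applies.\<close>
    then obtain E where E: "E \<in> sets ?P" "X -` B \<inter> space M = ?W -` E \<inter> space M"
      using measurable_space[OF samples_measurable[OF A]]
      unfolding hist_def by (subst (asm) sets_vimage_algebra2) auto
    define F where "F = (\<lambda>v. v (i, t)) -` C \<inter> space ?Q"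
    have F: "F \<in> sets ?Q" unfolding F_def by (rule measurable_sets[OF eval C])
    have "?V \<in> space M \<rightarrow> space ?Q"
      using indep_var_rv2[OF ind] by (auto dest: measurable_space)
    then have V: "\<xi> i t -` C \<inter> space M = ?V -` F \<inter> space M"
      by (auto simp: F_def)
    have "prob ((\<lambda>\<omega>. (X \<omega>, \<xi> i t \<omega>)) -` (B \<times> C) \<inter> space M)
        = prob ((\<lambda>\<omega>. (?W \<omega>, ?V \<omega>)) -` (E \<times> F) \<inter> space M)"
    proof -
      have "(\<lambda>\<omega>. (X \<omega>, \<xi> i t \<omega>)) -` (B \<times> C) \<inter> space M
          = (X -` B \<inter> space M) \<inter> (\<xi> i t -` C \<inter> space M)" by auto
      also have "\<dots> = (\<lambda>\<omega>. (?W \<omega>, ?V \<omega>)) -` (E \<times> F) \<inter> space M"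
        unfolding E(2) V by auto
      finally show ?thesis by simp
    qed
    also have "\<dots> = prob (X -` B \<inter> space M) * prob (\<xi> i t -` C \<inter> space M)"
      by (simp only: indep_varD[OF ind E(1) F] E(2) V)
    finally have "emeasure M ((\<lambda>\<omega>. (X \<omega>, \<xi> i t \<omega>)) -` (B \<times> C) \<inter> space M)
        = emeasure M (X -` B \<inter> space M) * emeasure M (\<xi> i t -` C \<inter> space M)"
      by (simp add: emeasure_eq_measure ennreal_mult)
    moreover have "emeasure (D i) C = emeasure M (\<xi> i t -` C \<inter> space M)"
      by (subst distr_sample[OF i(1), of t, symmetric]) (simp add: emeasure_distr C)
    ultimately show "emeasure (distr M N X) B * emeasure (D i) C
        = emeasure (distr M (N \<Otimes>\<^sub>M D i) (\<lambda>\<omega>. (X \<omega>, \<xi> i t \<omega>))) (B \<times> C)"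
      using B' C by (simp add: emeasure_distr)
  qed
qed

section \<open>Sampling noise at a point determined by the history\<close>

definition noise :: "(nat \<Rightarrow> 'z \<Rightarrow> real) \<Rightarrow> (nat \<Rightarrow> 'z \<Rightarrow> 's \<Rightarrow> 'z) \<Rightarrow> nat \<Rightarrow> nat \<Rightarrow>
    ('w \<Rightarrow> 'z::euclidean_space) \<Rightarrow> 'w \<Rightarrow> 'z" where
  "noise f g i t Z \<omega> = g i (Z \<omega>) (\<xi> i t \<omega>) - gradient (f i) (Z \<omega>)"

context
  fixes \<sigma> :: real and f :: "nat \<Rightarrow> 'a::euclidean_space \<times> 'b::euclidean_space \<Rightarrow> real"
    and g :: "nat \<Rightarrow> 'a \<times> 'b \<Rightarrow> 's \<Rightarrow> 'a \<times> 'b"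
    and A :: "(nat \<times> nat) set" and i t :: nat and Z :: "'w \<Rightarrow> 'a \<times> 'b"
  assumes bv: "bounded_variance \<sigma> n D f g" and A: "A \<subseteq> {..<n} \<times> UNIV"
    and i: "i < n" "(i, t) \<notin> A" and Z: "Z \<in> borel_measurable (hist A)"
    and grad: "gradient (f i) \<in> borel_measurable borel"
begin

lemma g_measurable [measurable]: "(\<lambda>(z, s). g i z s) \<in> borel_measurable (borel \<Otimes>\<^sub>M D i)"
  using bounded_varianceD(1)[OF bv i(1)] .

lemma noise_measurable_hist:
  "noise f g i t Z \<in> borel_measurable (hist (insert (i, t) A))"
proof -
  have I: "insert (i, t) A \<subseteq> {..<n} \<times> UNIV" using A i by auto
  have [measurable]: "Z \<in> borel_measurable (hist (insert (i, t) A))"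
    by (rule measurable_hist_mono[OF Z _ I]) auto
  have [measurable]: "\<xi> i t \<in> measurable (hist (insert (i, t) A)) (D i)"
    by (rule sample_measurable_hist[OF I]) auto
  note [measurable] = grad
  show ?thesis unfolding noise_def by measurable
qed

text \<open>By the product law the inner integral at each fixed point is bounded by the variance
  assumption. The computation uses nonnegative integrals, since integrability is itself part of the
  claim.\<close>

lemma noise_second_moment:
  "sq_int M (noise f g i t Z)" "(\<integral>\<omega>. (norm (noise f g i t Z \<omega>))\<^sup>2 \<partial>M) \<le> \<sigma>\<^sup>2"
proof -
  interpret Di: prob_space "D i" using D_prob i by auto
  note [measurable] = grad measurable_hist_imp[OF Z A] sample_measurable[OF i(1)]
  interpret PZ: prob_space "distr M borel Z" by (rule prob_space_distr) measurable
  have m [measurable]: "noise f g i t Z \<in> borel_measurable M"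
    unfolding noise_def by measurable
  define \<phi> where "\<phi> = (\<lambda>(z, s). ennreal ((norm (g i z s - gradient (f i) z))\<^sup>2))"
  have \<phi> [measurable]: "\<phi> \<in> borel_measurable (borel \<Otimes>\<^sub>M D i)"
    unfolding \<phi>_def by measurable
  have "(\<integral>\<^sup>+\<omega>. ennreal ((norm (noise f g i t Z \<omega>))\<^sup>2) \<partial>M) = (\<integral>\<^sup>+\<omega>. \<phi> (Z \<omega>, \<xi> i t \<omega>) \<partial>M)"
    by (simp add: \<phi>_def noise_def)
  also have "\<dots> = (\<integral>\<^sup>+p. \<phi> p \<partial>distr M (borel \<Otimes>\<^sub>M D i) (\<lambda>\<omega>. (Z \<omega>, \<xi> i t \<omega>)))"
    by (rule nn_integral_distr[symmetric]) measurable
  also have "\<dots> = (\<integral>\<^sup>+p. \<phi> p \<partial>(distr M borel Z \<Otimes>\<^sub>M D i))"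
    by (simp add: distr_hist_sample[OF Z A i])
  also have "\<dots> = (\<integral>\<^sup>+z. \<integral>\<^sup>+s. \<phi> (z, s) \<partial>D i \<partial>distr M borel Z)"
    by (rule Di.nn_integral_fst[symmetric]) measurable
  also have "\<dots> \<le> (\<integral>\<^sup>+z. ennreal (\<sigma>\<^sup>2) \<partial>distr M borel Z)"
  proof (rule nn_integral_mono)
    fix z
    have "(\<integral>\<^sup>+s. \<phi> (z, s) \<partial>D i) = ennreal (\<integral>s. (norm (g i z s - gradient (f i) z))\<^sup>2 \<partial>D i)"
      unfolding \<phi>_def prod.case
      by (intro nn_integral_eq_integral bounded_varianceD(4)[OF bv i(1)]) simp
    also have "\<dots> \<le> ennreal (\<sigma>\<^sup>2)"
      by (intro ennreal_leI bounded_varianceD(5)[OF bv i(1)])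
    finally show "(\<integral>\<^sup>+s. \<phi> (z, s) \<partial>D i) \<le> ennreal (\<sigma>\<^sup>2)" .
  qed
  also have "\<dots> = ennreal (\<sigma>\<^sup>2)"
    using PZ.emeasure_space_1 by simp
  finally have le: "(\<integral>\<^sup>+\<omega>. ennreal ((norm (noise f g i t Z \<omega>))\<^sup>2) \<partial>M) \<le> ennreal (\<sigma>\<^sup>2)" .
  then have int: "integrable M (\<lambda>\<omega>. (norm (noise f g i t Z \<omega>))\<^sup>2)"
    by (intro integrableI_bounded) (auto intro: le_less_trans)
  then show "sq_int M (noise f g i t Z)" by (simp add: sq_int_def m)
  show "(\<integral>\<omega>. (norm (noise f g i t Z \<omega>))\<^sup>2 \<partial>M) \<le> \<sigma>\<^sup>2"
    using le by (simp add: nn_integral_eq_integral[OF int])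
qed

text \<open>With the pair \<open>(V, Z)\<close> frozen, the inner integral is the inner product of a
  fixed vector with the mean noise at a fixed point, which is zero because the stochastic gradient
  is unbiased.\<close>

lemma noise_orthogonal:
  assumes V: "V \<in> borel_measurable (hist A)" "sq_int M V"
  shows "(\<integral>\<omega>. V \<omega> \<bullet> noise f g i t Z \<omega> \<partial>M) = 0"
proof -
  interpret Di: prob_space "D i" using D_prob i by auto
  note [measurable] = grad measurable_hist_imp[OF Z A] measurable_hist_imp[OF V(1) A]
    sample_measurable[OF i(1)]
  let ?N = "borel \<Otimes>\<^sub>M borel :: (('a \<times> 'b) \<times> ('a \<times> 'b)) measure"
  let ?X = "\<lambda>\<omega>. (V \<omega>, Z \<omega>)"
  have X: "?X \<in> measurable (hist A) ?N" using V(1) Z by measurable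
  have [measurable]: "?X \<in> measurable M ?N" by measurable
  interpret PX: prob_space "distr M ?N ?X" by (rule prob_space_distr) measurable
  interpret pair_sigma_finite "distr M ?N ?X" "D i" by unfold_locales
  define \<phi> where "\<phi> = (\<lambda>p. fst (fst p) \<bullet>
    (g i (snd (fst p)) (snd p) - gradient (f i) (snd (fst p))))"
  have \<phi> [measurable]: "\<phi> \<in> borel_measurable (?N \<Otimes>\<^sub>M D i)"
    unfolding \<phi>_def by measurable
  have eq: "V \<omega> \<bullet> noise f g i t Z \<omega> = \<phi> (?X \<omega>, \<xi> i t \<omega>)" for \<omega>
    by (simp add: \<phi>_def noise_def)
  have int: "integrable (distr M ?N ?X \<Otimes>\<^sub>M D i) \<phi>"
    unfolding distr_hist_sample[OF X A i, symmetric]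
    using sq_int_inner[OF V(2) noise_second_moment(1)]
    by (subst integrable_distr_eq) (simp_all add: eq)
  have "(\<integral>\<omega>. V \<omega> \<bullet> noise f g i t Z \<omega> \<partial>M) = (\<integral>\<omega>. \<phi> (?X \<omega>, \<xi> i t \<omega>) \<partial>M)"
    by (simp add: eq)
  also have "\<dots> = (\<integral>p. \<phi> p \<partial>distr M (?N \<Otimes>\<^sub>M D i) (\<lambda>\<omega>. (?X \<omega>, \<xi> i t \<omega>)))"
    by (rule integral_distr[symmetric]) measurable
  also have "\<dots> = (\<integral>p. \<phi> p \<partial>(distr M ?N ?X \<Otimes>\<^sub>M D i))"
    by (simp add: distr_hist_sample[OF X A i])
  also have "\<dots> = (\<integral>x. (\<integral>s. \<phi> (x, s) \<partial>D i) \<partial>distr M ?N ?X)"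
    by (rule integral_fst'[OF int, symmetric])
  also have "\<dots> = (\<integral>x. 0 \<partial>distr M ?N ?X)"
  proof (rule Bochner_Integration.integral_cong[OF refl])
    fix x :: "('a \<times> 'b) \<times> ('a \<times> 'b)"
    obtain v z where x: "x = (v, z)" by (cases x)
    note bounded_varianceD(2,3)[OF bv i(1), of z]
    then show "(\<integral>s. \<phi> (x, s) \<partial>D i) = 0"
      by (simp add: \<phi>_def x Di.prob_space)
  qed
  finally show ?thesis by simp
qed

end

end

section \<open>The Lyapunov function along one step\<close>

text \<open>\<open>P\<close> and \<open>h\<close> stand for \<open>\<Phi>\<close> and the gap,
  \<open>ex\<close> and \<open>ey\<close> for the squared momentum errors, \<open>X\<close> and
  \<open>Y\<close> for the squared norms of the momentum components, \<open>G\<close> for the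
  squared gradient of \<open>\<Phi>\<close>, \<open>q\<close> for the spread of the clients; primes
  and \<open>U\<close> belong to the next point. After substitution the excess of the left side over
  the right is linear in \<open>h\<close>, \<open>X\<close>, \<open>Y\<close>, \<open>ex\<close>,
  \<open>ey\<close> with nonpositive coefficients.\<close>

lemma lyapunov_arith:
  fixes a k L \<mu> \<eta>x \<eta>y :: real
  assumes P': "P' \<le> P + a * \<eta>x * ((8 * k * h + 2 * ex) / 2 - G / 2 - X / 2) + k * (a\<^sup>2 * \<eta>x\<^sup>2 * X)"
    and H': "h' \<le> h + a * \<eta>x * (2 * k * h + X / 2) + a * \<eta>y * (ey / 2 - \<mu> * h - Y / 2)
      + k * (a\<^sup>2 * \<eta>x\<^sup>2 * X + a\<^sup>2 * \<eta>y\<^sup>2 * Y)"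
    and U: "U \<le> (1 - 3 * a / 2) * (ex + ey) + 2 / 3 * L\<^sup>2 * a * (\<eta>x\<^sup>2 * X + \<eta>y\<^sup>2 * Y) + 3 * a * L\<^sup>2 * q"
    and nonneg: "h \<ge> 0" "X \<ge> 0" "Y \<ge> 0" "ex \<ge> 0" "ey \<ge> 0"
    and pos: "a > 0" "k > 0" "L > 0" "0 < \<eta>x" "\<eta>x \<le> \<eta>y"
    and step: "26 * k * \<eta>x \<le> \<mu> * \<eta>y" "k * a * \<eta>y \<le> 1 / 4" "6 * L * \<eta>y \<le> 1"
  shows "P' + h' / 6 + (\<eta>x + \<eta>y) * U \<le>
    P + h / 6 + (\<eta>x + \<eta>y) * (ex + ey) - a * \<eta>x / 2 * G + (\<eta>x + \<eta>y) * (3 * a * L\<^sup>2 * q)"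
proof -
  \<comment> \<open>The number 26 in \<open>step\<close> is what makes this coefficient nonpositive:
    4 + 1/3 = 26/6.\<close>
  have ch: "(4 * k * \<eta>x + k * \<eta>x / 3 - \<mu> * \<eta>y / 6) * h \<le> 0"
  proof (rule mult_nonpos_nonneg)
    show "4 * k * \<eta>x + k * \<eta>x / 3 - \<mu> * \<eta>y / 6 \<le> 0" using step(1) by linarith
  qed fact
  have "k * a * \<eta>x \<le> k * a * \<eta>y"
    using pos by (intro mult_left_mono) auto
  with step(2) have kx: "k * a * \<eta>x \<le> 1 / 4" by linarith
  \<comment> \<open>The 6 in \<open>6 * L * \<eta>y \<le> 1\<close> produces the 1/27 below, and
    -1/12 + 1/24 + 1/27, the bound for the coefficient of \<open>Y\<close>, is still
    negative.\<close>
  have "(6 * L * \<eta>y)\<^sup>2 \<le> 1" using step(3) pos by (intro power_le_one) auto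
  then have Ly: "L\<^sup>2 * \<eta>y\<^sup>2 \<le> 1 / 36" by (simp add: power_mult_distrib)
  have yp: "\<eta>y > 0" using pos by simp
  have "L\<^sup>2 * ((\<eta>x + \<eta>y) * \<eta>y) \<le> L\<^sup>2 * ((\<eta>y + \<eta>y) * \<eta>y)"
    using pos by (intro mult_left_mono mult_right_mono) auto
  also have "\<dots> = 2 * (L\<^sup>2 * \<eta>y\<^sup>2)" by (simp add: power2_eq_square)
  finally have y1: "L\<^sup>2 * ((\<eta>x + \<eta>y) * \<eta>y) \<le> 1 / 18" using Ly by simp
  have "L\<^sup>2 * ((\<eta>x + \<eta>y) * \<eta>x) \<le> L\<^sup>2 * ((\<eta>x + \<eta>y) * \<eta>y)"
    using pos by (intro mult_left_mono) auto
  with y1 have x1: "L\<^sup>2 * ((\<eta>x + \<eta>y) * \<eta>x) \<le> 1 / 18" by simp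
  define c where "c = 2 / 3 * L\<^sup>2"
  have x2: "c * ((\<eta>x + \<eta>y) * \<eta>x) \<le> 1 / 27" and y2: "c * ((\<eta>x + \<eta>y) * \<eta>y) \<le> 1 / 27"
    using x1 y1 by (auto simp: c_def mult_ac)
  have cX: "\<eta>x * (- 5 / 12 + 7 / 6 * (k * a * \<eta>x) + c * ((\<eta>x + \<eta>y) * \<eta>x)) * X \<le> 0"
    using kx x2 nonneg pos by (intro mult_nonpos_nonneg mult_nonneg_nonpos) auto
  have cY: "\<eta>y * (- 1 / 12 + 1 / 6 * (k * a * \<eta>y) + c * ((\<eta>x + \<eta>y) * \<eta>y)) * Y \<le> 0"
    using step(2) y2 nonneg yp by (intro mult_nonpos_nonneg mult_nonneg_nonpos) auto
  \<comment> \<open>These are the remainders of the contraction of the momentum error after it has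
    paid for the error terms of the descent inequalities.\<close>
  have "0 \<le> ex * (\<eta>x / 2 + 3 / 2 * \<eta>y)" "0 \<le> ey * (3 / 2 * \<eta>x + 17 / 12 * \<eta>y)"
    using nonneg pos yp by auto
  then have cE: "\<eta>x * ex + \<eta>y * ey / 12 - 3 / 2 * (\<eta>x + \<eta>y) * (ex + ey) \<le> 0"
    by (simp add: algebra_simps)
  let ?P = "P + a * \<eta>x * ((8 * k * h + 2 * ex) / 2 - G / 2 - X / 2) + k * (a\<^sup>2 * \<eta>x\<^sup>2 * X)"
    and ?H = "h + a * \<eta>x * (2 * k * h + X / 2) + a * \<eta>y * (ey / 2 - \<mu> * h - Y / 2)
      + k * (a\<^sup>2 * \<eta>x\<^sup>2 * X + a\<^sup>2 * \<eta>y\<^sup>2 * Y)"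
    and ?U = "(1 - 3 * a / 2) * (ex + ey) + c * a * (\<eta>x\<^sup>2 * X + \<eta>y\<^sup>2 * Y) + 3 * a * L\<^sup>2 * q"
    and ?R = "P + h / 6 + (\<eta>x + \<eta>y) * (ex + ey) - a * \<eta>x / 2 * G
      + (\<eta>x + \<eta>y) * (3 * a * L\<^sup>2 * q)"
  have U': "(\<eta>x + \<eta>y) * U \<le> (\<eta>x + \<eta>y) * ?U"
    using U[folded c_def] pos by (intro mult_left_mono) auto
  have eq: "?P + ?H / 6 + (\<eta>x + \<eta>y) * ?U - ?R
    = a * ((4 * k * \<eta>x + k * \<eta>x / 3 - \<mu> * \<eta>y / 6) * h
      + \<eta>x * (- 5 / 12 + 7 / 6 * (k * a * \<eta>x) + c * ((\<eta>x + \<eta>y) * \<eta>x)) * X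
      + \<eta>y * (- 1 / 12 + 1 / 6 * (k * a * \<eta>y) + c * ((\<eta>x + \<eta>y) * \<eta>y)) * Y
      + (\<eta>x * ex + \<eta>y * ey / 12 - 3 / 2 * (\<eta>x + \<eta>y) * (ex + ey)))"
    by (simp add: field_simps power2_eq_square)
  have le: "\<dots> \<le> 0"
    using ch cX cY cE pos(1) by (intro mult_nonneg_nonpos) auto
  have combine: "p1 + p2 / 6 + p3 \<le> r"
    if "p1 \<le> q1" "p2 \<le> q2" "p3 \<le> q3" "q1 + q2 / 6 + q3 - r = s" "s \<le> 0"
    for p1 p2 p3 q1 q2 q3 r s :: real
    using that by linarith
  show ?thesis by (rule combine[OF P' H' U' eq le])
qed

section \<open>Standing assumptions and the regularity of the global function, its maximum and its
  gap\<close>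

lemma GDERIV_global_fun:
  assumes "\<And>i. i < n \<Longrightarrow> GDERIV (f i) z :> G i"
  shows "GDERIV (global_fun n f) z :> avg n G"
proof -
  have "((\<lambda>z. (1 / real n) *\<^sub>R (\<Sum>i<n. f i z)) has_derivative
      (\<lambda>h. (1 / real n) *\<^sub>R (\<Sum>i<n. h \<bullet> G i))) (at z)"
    using assms by (intro has_derivative_scaleR_right has_derivative_sum) (auto simp: gderiv_def)
  then show ?thesis
    by (simp add: gderiv_def global_fun_def[abs_def] avg_def inner_sum_right)
qed

text \<open>\<open>k\<close> is one quadratic constant for both \<open>\<Phi>\<close> and the gap:
  the gap costs \<open>L + L\<^sup>2 / (2 * \<mu>)\<close> for \<open>\<Phi>\<close> and another
  \<open>L\<close> for the global function. \<open>\<mu> \<le> k\<close> yields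
  \<open>\<eta>x \<le> \<eta>y\<close>, \<open>3 * a \<le> 1\<close> makes the momentum update a
  convex combination, and \<open>a * real \<tau> \<le> 1\<close> limits the drift within a
  round.\<close>

locale local_sgda = fresh_sampling M n D \<xi>
  for M :: "'w measure" and n D and \<xi> :: "nat \<Rightarrow> nat \<Rightarrow> 'w \<Rightarrow> 's" +
  fixes f :: "nat \<Rightarrow> 'a::euclidean_space \<times> 'b::euclidean_space \<Rightarrow> real"
    and g :: "nat \<Rightarrow> 'a \<times> 'b \<Rightarrow> 's \<Rightarrow> 'a \<times> 'b"
    and x0 :: 'a and y0 :: 'b and \<tau> :: nat
    and L \<mu> \<sigma> Z k \<eta>x \<eta>y a :: real
  assumes n: "n \<ge> 1"
    and smooth: "smooth_clients L n f"
    and bv: "bounded_variance \<sigma> n D f g"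
    and het: "\<And>z. avg n (\<lambda>i. (norm (gradient (f i) z - gradient (global_fun n f) z))\<^sup>2) \<le> Z"
    and PL: "PL_in_y \<mu> (global_fun n f)"
    and L: "L > 0" and \<mu>: "\<mu> > 0"
    and k: "2 * L + L\<^sup>2 / (2 * \<mu>) \<le> k" "\<mu> \<le> k"
    and \<eta>x: "\<eta>x > 0" "26 * k * \<eta>x \<le> \<mu> * \<eta>y" and \<eta>y: "6 * L * \<eta>y \<le> 1"
    and a: "a > 0" "3 * a \<le> 1" "k * a * \<eta>y \<le> 1 / 4" "a * real \<tau> \<le> 1"
    and \<tau>: "\<tau> \<ge> 1"
begin

abbreviation "F \<equiv> global_fun n f"
abbreviation "\<Phi> \<equiv> max_y F"

lemma k_pos: "k > 0" using k \<mu> by simp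

lemma \<eta>x_le: "\<eta>x \<le> \<eta>y" and \<eta>y_pos: "\<eta>y > 0"
proof -
  have "0 < 26 * k * \<eta>x" using k_pos \<eta>x by simp
  then have "0 < \<mu> * \<eta>y" using \<eta>x by linarith
  then show p: "\<eta>y > 0" using \<mu> by (simp add: zero_less_mult_iff)
  have "k * \<eta>x \<le> 26 * k * \<eta>x" using k_pos \<eta>x by simp
  also have "\<dots> \<le> \<mu> * \<eta>y" by (rule \<eta>x(2))
  also have "\<dots> \<le> k * \<eta>y" using k p by simp
  finally show "\<eta>x \<le> \<eta>y" using k_pos by simp
qed

lemma client_GDERIV: "i < n \<Longrightarrow> GDERIV (f i) z :> gradient (f i) z"
  using smooth unfolding smooth_clients_def by (blast intro: GDERIV_gradient)

lemma client_Lipschitz: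
  "i < n \<Longrightarrow> norm (gradient (f i) z - gradient (f i) z') \<le> L * norm (z - z')"
  using smooth unfolding smooth_clients_def by blast

lemma client_gradient_measurable: "i < n \<Longrightarrow> gradient (f i) \<in> borel_measurable borel"
  using client_Lipschitz L
  by (intro borel_measurable_continuous_onI lipschitz_on_continuous_on[of L])
    (auto simp: lipschitz_on_def dist_norm)

lemma gradient_F: "gradient F z = avg n (\<lambda>i. gradient (f i) z)"
  by (intro gradient_eqI GDERIV_global_fun client_GDERIV)

lemma F_GDERIV: "GDERIV F z :> gradient F z"
  unfolding gradient_F by (intro GDERIV_global_fun client_GDERIV)

lemma F_Lipschitz: "norm (gradient F z - gradient F z') \<le> L * norm (z - z')"
proof (rule power2_le_imp_le)
  have "(norm (gradient F z - gradient F z'))\<^sup>2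
      \<le> avg n (\<lambda>i. (norm (gradient (f i) z - gradient (f i) z'))\<^sup>2)"
    unfolding gradient_F avg_diff[symmetric] by (rule norm_avg_sq_le[OF n])
  also have "\<dots> \<le> (L * norm (z - z'))\<^sup>2"
    by (intro avg_le_const[OF n] power_mono client_Lipschitz) auto
  finally show "(norm (gradient F z - gradient F z'))\<^sup>2 \<le> (L * norm (z - z'))\<^sup>2" .
qed (use L in simp)

lemma F_quad_bound: "quad_bound L F (gradient F)"
  using Lipschitz_gradient_quad_bound[OF F_GDERIV F_Lipschitz] L by simp

lemma \<Phi>_quad_bound: "quad_bound k \<Phi> (gradient \<Phi>)"
  using k L by (intro quad_bound_mono[OF max_y_quad_bound[OF F_GDERIV F_Lipschitz L \<mu> PL]]) linarith

lemma gap_quad_bound_k: "quad_bound k (gap F) (gap_gradient F)"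
proof (rule quad_bound_mono)
  show "quad_bound ((L + L\<^sup>2 / (2 * \<mu>)) + L) (gap F) (gap_gradient F)"
    using L \<mu>
    by (intro gap_quad_bound max_y_quad_bound[OF F_GDERIV F_Lipschitz L \<mu> PL] F_quad_bound) simp
qed (use k in simp)

lemma gap_ge0: "gap F z \<ge> 0"
  by (rule gap_nonneg[OF PL])

text \<open>Descent in \<open>x\<close> and ascent in \<open>y\<close> as a single linear map, so
  that a client moves by \<open>a *\<^sub>R scale d\<close> in the product space.\<close>

definition scale :: "'a \<times> 'b \<Rightarrow> 'a \<times> 'b" where
  "scale v = (- \<eta>x *\<^sub>R fst v, \<eta>y *\<^sub>R snd v)"

lemma scale_bounded_linear: "bounded_linear scale"
  unfolding scale_def
  by (intro bounded_linear_Pair bounded_linear_scaleR_right[THEN bounded_linear_compose]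
      bounded_linear_fst bounded_linear_snd)

lemma scale_linear: "linear scale"
  using scale_bounded_linear by (rule bounded_linear.linear)

lemma norm_scale_sq: "(norm (scale v))\<^sup>2 = \<eta>x\<^sup>2 * (norm (fst v))\<^sup>2 + \<eta>y\<^sup>2 * (norm (snd v))\<^sup>2"
  by (simp add: scale_def norm_Pair_sq power_mult_distrib)

lemma norm_scale_sq_le: "(norm (scale v))\<^sup>2 \<le> \<eta>y\<^sup>2 * (norm v)\<^sup>2"
proof -
  have "\<eta>x\<^sup>2 * (norm (fst v))\<^sup>2 \<le> \<eta>y\<^sup>2 * (norm (fst v))\<^sup>2"
    using \<eta>x \<eta>x_le by (intro mult_right_mono power_mono) auto
  then show ?thesis
    unfolding norm_scale_sq norm_sq_fst_snd[of v] by (simp add: distrib_left)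
qed

text \<open>\<open>u\<close> is meant to be the part of the next momentum error that is known before
  the fresh samples; the noise is added later. The descent inequalities for \<open>\<Phi>\<close>
  and for the gap are brought into the form of \<open>lyapunov_arith\<close>.\<close>

lemma lyapunov_step:
  assumes U: "(norm u)\<^sup>2 \<le> (1 - 3 * a / 2) * (norm (d - gradient F z))\<^sup>2
      + 2 / 3 * L\<^sup>2 * a * (norm (scale d))\<^sup>2 + 3 * a * L\<^sup>2 * q"
    and z': "z' = z + a *\<^sub>R scale d"
  shows "\<Phi> (fst z') + gap F z' / 6 + (\<eta>x + \<eta>y) * (norm u)\<^sup>2 \<le>
    \<Phi> (fst z) + gap F z / 6 + (\<eta>x + \<eta>y) * (norm (d - gradient F z))\<^sup>2
    - a * \<eta>x / 2 * (norm (gradient \<Phi> (fst z)))\<^sup>2 + (\<eta>x + \<eta>y) * (3 * a * L\<^sup>2 * q)"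
proof -
  define p where "p = gradient \<Phi> (fst z)"
  define gx where "gx = fst (gradient F z)"
  define gy where "gy = snd (gradient F z)"
  define dx where "dx = fst d"
  define dy where "dy = snd d"
  define ex where "ex = (norm (dx - gx))\<^sup>2"
  define ey where "ey = (norm (dy - gy))\<^sup>2"
  have e: "(norm (d - gradient F z))\<^sup>2 = ex + ey"
    by (simp add: norm_sq_fst_snd[of "d - _"] ex_def ey_def dx_def dy_def gx_def gy_def)
  have W: "gap_gradient F z = (p - gx, - gy)"
    by (simp add: gap_gradient_def p_def gx_def gy_def prod_eq_iff)
  have "(norm (gap_gradient F z))\<^sup>2 \<le> 4 * k * gap F z"
    by (rule nonneg_gradient_sq_le[OF gap_quad_bound_k k_pos gap_ge0])
  \<comment> \<open>The first component of the gap gradient is the error made when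
    \<open>grad_x F\<close> replaces the gradient of \<open>\<Phi>\<close>; the gap itself controls
    it.\<close>
  then have Wx: "(norm (p - gx))\<^sup>2 \<le> 4 * k * gap F z"
    unfolding W norm_Pair_sq using zero_le_power2[of "norm (- gy)"] by linarith
  have PLz: "2 * \<mu> * gap F z \<le> (norm gy)\<^sup>2"
    using PL unfolding PL_in_y_def gap_def grad_y_def gy_def by (metis prod.collapse)
  have zz: "z' - z = (- (a * \<eta>x) *\<^sub>R dx, (a * \<eta>y) *\<^sub>R dy)"
    by (simp add: z' scale_def dx_def dy_def)
  have zx: "fst z' - fst z = - (a * \<eta>x) *\<^sub>R dx"
    using zz by (metis fst_conv fst_diff)
  have "\<Phi> (fst z') \<le> \<Phi> (fst z) + p \<bullet> (fst z' - fst z) + k * (norm (fst z' - fst z))\<^sup>2"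
    using quad_boundD[OF \<Phi>_quad_bound, of "fst z'" "fst z"] by (simp add: p_def)
  \<comment> \<open>Polarization: besides the wanted \<open>- norm p ^ 2 / 2\<close> it leaves
    \<open>- norm dx ^ 2 / 2\<close>, which absorbs the terms quadratic in the step.\<close>
  moreover have "p \<bullet> (fst z' - fst z)
      = a * \<eta>x * ((norm (p - dx))\<^sup>2 / 2 - (norm p)\<^sup>2 / 2 - (norm dx)\<^sup>2 / 2)"
    unfolding zx by (simp add: power2_norm_eq_inner inner_diff_left inner_diff_right inner_commute)
      (simp add: field_simps)
  moreover have "(norm (fst z' - fst z))\<^sup>2 = a\<^sup>2 * \<eta>x\<^sup>2 * (norm dx)\<^sup>2"
    unfolding zx by (simp add: power_mult_distrib)
  moreover have "a * \<eta>x * ((norm (p - dx))\<^sup>2 / 2 - (norm p)\<^sup>2 / 2 - (norm dx)\<^sup>2 / 2)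
      \<le> a * \<eta>x * ((8 * k * gap F z + 2 * ex) / 2 - (norm p)\<^sup>2 / 2 - (norm dx)\<^sup>2 / 2)"
  proof -
    have "(norm (p - dx))\<^sup>2 \<le> 2 * (norm (p - gx))\<^sup>2 + 2 * (norm (gx - dx))\<^sup>2"
      using norm_add_sq_le2[of "p - gx" "gx - dx"] by simp
    also have "\<dots> \<le> 8 * k * gap F z + 2 * ex"
      using Wx by (simp add: ex_def norm_minus_commute)
    finally show ?thesis
      using a(1) \<eta>x(1) by (intro mult_left_mono) auto
  qed
  ultimately have P': "\<Phi> (fst z') \<le> \<Phi> (fst z)
      + a * \<eta>x * ((8 * k * gap F z + 2 * ex) / 2 - (norm p)\<^sup>2 / 2 - (norm dx)\<^sup>2 / 2)
      + k * (a\<^sup>2 * \<eta>x\<^sup>2 * (norm dx)\<^sup>2)" by simp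
  have "gap F z' \<le> gap F z + gap_gradient F z \<bullet> (z' - z) + k * (norm (z' - z))\<^sup>2"
    using quad_boundD[OF gap_quad_bound_k, of z' z] by simp
  moreover have "gap_gradient F z \<bullet> (z' - z)
      = a * \<eta>x * (- ((p - gx) \<bullet> dx)) + a * \<eta>y * (- (gy \<bullet> dy))"
    unfolding W zz by (simp add: inner_prod_def)
  moreover have "(norm (z' - z))\<^sup>2 = a\<^sup>2 * \<eta>x\<^sup>2 * (norm dx)\<^sup>2 + a\<^sup>2 * \<eta>y\<^sup>2 * (norm dy)\<^sup>2"
    unfolding zz norm_Pair_sq by (simp add: power_mult_distrib)
  moreover have "a * \<eta>x * (- ((p - gx) \<bullet> dx)) \<le> a * \<eta>x * (2 * k * gap F z + (norm dx)\<^sup>2 / 2)"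
  proof (rule mult_left_mono)
    have "0 \<le> (norm ((p - gx) + dx))\<^sup>2" by simp
    then have "- ((p - gx) \<bullet> dx) \<le> (norm (p - gx))\<^sup>2 / 2 + (norm dx)\<^sup>2 / 2"
      by (simp add: power2_norm_eq_inner inner_add_left inner_add_right inner_commute)
    then show "- ((p - gx) \<bullet> dx) \<le> 2 * k * gap F z + (norm dx)\<^sup>2 / 2" using Wx by simp
  qed (use a \<eta>x in simp)
  moreover have "a * \<eta>y * (- (gy \<bullet> dy)) \<le> a * \<eta>y * (ey / 2 - \<mu> * gap F z - (norm dy)\<^sup>2 / 2)"
  proof (rule mult_left_mono)
    have "- (gy \<bullet> dy) = ey / 2 - (norm gy)\<^sup>2 / 2 - (norm dy)\<^sup>2 / 2"
      by (simp add: ey_def power2_norm_eq_inner inner_diff_left inner_diff_right inner_commute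
          diff_divide_distrib add_divide_distrib)
    then show "- (gy \<bullet> dy) \<le> ey / 2 - \<mu> * gap F z - (norm dy)\<^sup>2 / 2" using PLz by simp
  qed (use a \<eta>y_pos in simp)
  ultimately have H': "gap F z' \<le> gap F z + a * \<eta>x * (2 * k * gap F z + (norm dx)\<^sup>2 / 2)
      + a * \<eta>y * (ey / 2 - \<mu> * gap F z - (norm dy)\<^sup>2 / 2)
      + k * (a\<^sup>2 * \<eta>x\<^sup>2 * (norm dx)\<^sup>2 + a\<^sup>2 * \<eta>y\<^sup>2 * (norm dy)\<^sup>2)" by simp
  have U': "(norm u)\<^sup>2 \<le> (1 - 3 * a / 2) * (ex + ey)
      + 2 / 3 * L\<^sup>2 * a * (\<eta>x\<^sup>2 * (norm dx)\<^sup>2 + \<eta>y\<^sup>2 * (norm dy)\<^sup>2) + 3 * a * L\<^sup>2 * q"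
    using U unfolding e norm_scale_sq dx_def dy_def .
  show ?thesis
    unfolding e p_def[symmetric]
    by (rule lyapunov_arith[OF P' H' U'])
      (use gap_ge0 a k_pos L \<eta>x \<eta>x_le \<eta>y in \<open>auto simp: ex_def ey_def\<close>)
qed

text \<open>\<open>\<delta>\<close> is the change of the gradient caused by the move of the mean,
  \<open>bias\<close> the error from evaluating gradients at different client positions. With
  \<open>b = 3 * a\<close>, Young's inequality with weight \<open>b / 2\<close> spends half of the
  contraction \<open>b\<close>, leaving \<open>1 - b / 2\<close>.\<close>

lemma error_step:
  fixes e \<delta> bias :: "'v::real_inner"
  assumes "(norm \<delta>)\<^sup>2 \<le> L\<^sup>2 * (a\<^sup>2 * s)" "(norm bias)\<^sup>2 \<le> L\<^sup>2 * q" "s \<ge> 0"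
  shows "(norm ((1 - 3 * a) *\<^sub>R (e + \<delta>) + (3 * a) *\<^sub>R bias))\<^sup>2
    \<le> (1 - 3 * a / 2) * (norm e)\<^sup>2 + 2 / 3 * L\<^sup>2 * a * s + 3 * a * L\<^sup>2 * q"
proof -
  define b where "b = 3 * a"
  have b: "0 < b" "b \<le> 1" using a by (auto simp: b_def)
  have "(norm ((1 - b) *\<^sub>R (e + \<delta>) + b *\<^sub>R bias))\<^sup>2
      \<le> (1 - b) * (norm (e + \<delta>))\<^sup>2 + b * (norm bias)\<^sup>2"
    using b by (intro norm_convex_sq_le) auto
  also have "\<dots> \<le> (1 - b) * ((1 + b / 2) * (norm e)\<^sup>2 + (1 + 2 / b) * (norm \<delta>)\<^sup>2)
      + b * (L\<^sup>2 * q)"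
    using norm_add_sq_le[of "b / 2" e \<delta>] b assms(2)
    by (intro add_mono mult_left_mono) auto
  also have "\<dots> = ((1 - b) * (1 + b / 2)) * (norm e)\<^sup>2 + ((1 - b) * (1 + 2 / b)) * (norm \<delta>)\<^sup>2
      + b * (L\<^sup>2 * q)"
    by (simp add: algebra_simps)
  also have "\<dots> \<le> (1 - b / 2) * (norm e)\<^sup>2 + (2 / b) * (L\<^sup>2 * (a\<^sup>2 * s)) + b * (L\<^sup>2 * q)"
  proof (intro add_mono order_refl)
    have c: "(1 - b) * (1 + b / 2) \<le> 1 - b / 2" "(1 - b) * (1 + 2 / b) \<le> 2 / b"
      using b by (auto simp: field_simps)
    show "((1 - b) * (1 + b / 2)) * (norm e)\<^sup>2 \<le> (1 - b / 2) * (norm e)\<^sup>2"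
      using c(1) by (intro mult_right_mono) auto
    show "((1 - b) * (1 + 2 / b)) * (norm \<delta>)\<^sup>2 \<le> (2 / b) * (L\<^sup>2 * (a\<^sup>2 * s))"
      using c(2) b by (intro mult_mono assms(1)) auto
  qed
  also have "(2 / b) * (L\<^sup>2 * (a\<^sup>2 * s)) = 2 / 3 * L\<^sup>2 * a * s"
    using a by (simp add: b_def power2_eq_square)
  finally show ?thesis by (simp add: b_def)
qed

end

section \<open>Drift of the clients\<close>

lemma integrable_avg:
  fixes X :: "nat \<Rightarrow> 'w \<Rightarrow> real"
  shows "(\<And>i. i < n \<Longrightarrow> integrable M (X i)) \<Longrightarrow> integrable M (\<lambda>\<omega>. avg n (\<lambda>i. X i \<omega>))"
  unfolding avg_def real_scaleR_def
  by (intro integrable_mult_right Bochner_Integration.integrable_sum) auto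

lemma integral_avg:
  fixes X :: "nat \<Rightarrow> 'w \<Rightarrow> real"
  assumes "\<And>i. i < n \<Longrightarrow> integrable M (X i)"
  shows "(\<integral>\<omega>. avg n (\<lambda>i. X i \<omega>) \<partial>M) = avg n (\<lambda>i. \<integral>\<omega>. X i \<omega> \<partial>M)"
  using assms by (simp add: avg_def Bochner_Integration.integral_sum)

lemma borel_measurable_avg:
  fixes X :: "nat \<Rightarrow> 'w \<Rightarrow> 'v::euclidean_space"
  shows "(\<And>i. i < n \<Longrightarrow> X i \<in> borel_measurable M) \<Longrightarrow> (\<lambda>\<omega>. avg n (\<lambda>i. X i \<omega>)) \<in> borel_measurable M"
  unfolding avg_def by (intro borel_measurable_scaleR borel_measurable_sum) auto

lemma norm_avg_sq_expand:
  fixes v :: "nat \<Rightarrow> 'v::real_inner"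
  shows "(norm (avg n v))\<^sup>2 = (\<Sum>i<n. \<Sum>j<n. v i \<bullet> v j) / (real n)\<^sup>2"
proof -
  have "(norm (sum v {..<n}))\<^sup>2 = (\<Sum>i<n. v i \<bullet> sum v {..<n})"
    by (simp only: power2_norm_eq_inner inner_sum_left)
  also have "\<dots> = (\<Sum>i<n. \<Sum>j<n. v i \<bullet> v j)"
    by (simp only: inner_sum_right)
  finally show ?thesis by (simp add: avg_def power_divide)
qed

context local_sgda
begin

text \<open>The gain of the factor \<open>1 / n\<close>: of the \<open>n ^ 2\<close> inner products
  only the \<open>n\<close> diagonal ones survive in expectation.\<close>

lemma noise_avg_second_moment:
  assumes A: "A \<subseteq> {..<n} \<times> UNIV" and s: "\<And>i. (i, s) \<notin> A"
    and X: "\<And>i. i < n \<Longrightarrow> X i \<in> borel_measurable (hist A)"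
  shows "(\<integral>\<omega>. (norm (avg n (\<lambda>i. noise f g i s (X i) \<omega>)))\<^sup>2 \<partial>M) \<le> \<sigma>\<^sup>2 / real n"
proof -
  let ?N = "\<lambda>i. noise f g i s (X i)"
  note grad = client_gradient_measurable
  have sq: "sq_int M (?N i)" "(\<integral>\<omega>. (norm (?N i \<omega>))\<^sup>2 \<partial>M) \<le> \<sigma>\<^sup>2" if "i < n" for i
    using noise_second_moment[OF bv A that s X[OF that] grad[OF that]] by auto
  \<comment> \<open>The sample of client \<open>i\<close> is added to the history, which makes its
    noise known; the sample of client \<open>j\<close> at the same time is still fresh.\<close>
  have orth: "(\<integral>\<omega>. ?N i \<omega> \<bullet> ?N j \<omega> \<partial>M) = 0" if ij: "i < n" "j < n" "i \<noteq> j" for i j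
  proof (rule noise_orthogonal[OF bv _ _ _ _ grad])
    show I: "insert (i, s) A \<subseteq> {..<n} \<times> UNIV" using A ij by auto
    show "(j, s) \<notin> insert (i, s) A" using s ij by auto
    show "X j \<in> borel_measurable (hist (insert (i, s) A))"
      by (rule measurable_hist_mono[OF X _ I]) (use ij in auto)
    show "?N i \<in> borel_measurable (hist (insert (i, s) A))"
      by (rule noise_measurable_hist[OF bv A ij(1) s X[OF ij(1)] grad[OF ij(1)]])
  qed (use ij sq in auto)
  have "(\<integral>\<omega>. (norm (avg n (\<lambda>i. ?N i \<omega>)))\<^sup>2 \<partial>M)
      = (\<Sum>i<n. \<Sum>j<n. \<integral>\<omega>. ?N i \<omega> \<bullet> ?N j \<omega> \<partial>M) / (real n)\<^sup>2"
  proof -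
    have "(\<integral>\<omega>. (\<Sum>i<n. \<Sum>j<n. ?N i \<omega> \<bullet> ?N j \<omega>) \<partial>M)
        = (\<Sum>i<n. \<integral>\<omega>. (\<Sum>j<n. ?N i \<omega> \<bullet> ?N j \<omega>) \<partial>M)"
      by (intro Bochner_Integration.integral_sum Bochner_Integration.integrable_sum sq_int_inner sq) auto
    also have "\<dots> = (\<Sum>i<n. \<Sum>j<n. \<integral>\<omega>. ?N i \<omega> \<bullet> ?N j \<omega> \<partial>M)"
      by (intro sum.cong refl Bochner_Integration.integral_sum sq_int_inner sq) auto
    finally show ?thesis by (simp add: norm_avg_sq_expand)
  qed
  also have "(\<Sum>i<n. \<Sum>j<n. \<integral>\<omega>. ?N i \<omega> \<bullet> ?N j \<omega> \<partial>M)
      = (\<Sum>i<n. \<Sum>j<n. if j = i then \<integral>\<omega>. (norm (?N i \<omega>))\<^sup>2 \<partial>M else 0)"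
    using orth by (intro sum.cong refl) (auto simp: power2_norm_eq_inner)
  also have "\<dots> = (\<Sum>i<n. \<integral>\<omega>. (norm (?N i \<omega>))\<^sup>2 \<partial>M)"
    by simp
  also have "\<dots> \<le> real n * \<sigma>\<^sup>2"
    using sum_mono[of "{..<n}" "\<lambda>i. \<integral>\<omega>. (norm (?N i \<omega>))\<^sup>2 \<partial>M" "\<lambda>_. \<sigma>\<^sup>2"] sq(2) by simp
  also have "real n * \<sigma>\<^sup>2 / (real n)\<^sup>2 = \<sigma>\<^sup>2 / real n"
    using n by (simp add: power2_eq_square)
  finally show ?thesis using n by (simp add: divide_right_mono)
qed

section \<open>The iterates as random vectors\<close>

definition state :: "nat \<Rightarrow> nat \<Rightarrow> 'w \<Rightarrow> ('a, 'b) client_state" where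
  "state t i \<omega> =
    momentum_local_sgda n \<tau> \<eta>x \<eta>y 3 3 (\<lambda>_. a) (\<lambda>j s z. g j z (\<xi> j s \<omega>)) x0 y0 t i"

definition pos :: "nat \<Rightarrow> nat \<Rightarrow> 'w \<Rightarrow> 'a \<times> 'b" where
  "pos t i \<omega> = (xc (state t i \<omega>), yc (state t i \<omega>))"

definition dir :: "nat \<Rightarrow> nat \<Rightarrow> 'w \<Rightarrow> 'a \<times> 'b" where
  "dir t i \<omega> = (dx (state t i \<omega>), dy (state t i \<omega>))"

text \<open>The state of client \<open>i\<close> after a local step and before a possible averaging.\<close>

definition loc_pos :: "nat \<Rightarrow> nat \<Rightarrow> 'w \<Rightarrow> 'a \<times> 'b" where
  "loc_pos t i \<omega> = pos t i \<omega> + a *\<^sub>R scale (dir t i \<omega>)"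

definition loc_noise :: "nat \<Rightarrow> nat \<Rightarrow> 'w \<Rightarrow> 'a \<times> 'b" where
  "loc_noise t i = noise f g i (Suc t) (loc_pos t i)"

text \<open>This is the stochastic gradient
  \<open>g i (loc_pos t i \<omega>) (\<xi> i (Suc t) \<omega>)\<close>, kept in the split form that
  the variance and bias estimates use.\<close>

definition loc_grad :: "nat \<Rightarrow> nat \<Rightarrow> 'w \<Rightarrow> 'a \<times> 'b" where
  "loc_grad t i \<omega> = loc_noise t i \<omega> + gradient (f i) (loc_pos t i \<omega>)"

definition loc_dir :: "nat \<Rightarrow> nat \<Rightarrow> 'w \<Rightarrow> 'a \<times> 'b" where
  "loc_dir t i \<omega> = (1 - 3 * a) *\<^sub>R dir t i \<omega> + (3 * a) *\<^sub>R loc_grad t i \<omega>"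

lemma pos_0: "pos 0 i \<omega> = (x0, y0)"
  by (simp add: pos_def state_def)

lemma dir_0: "dir 0 i \<omega> = noise f g i 0 (\<lambda>_. (x0, y0)) \<omega> + gradient (f i) (x0, y0)"
  by (simp add: dir_def state_def noise_def)

lemma local_step_eq:
  "(xc (local_step \<eta>x \<eta>y 3 3 a G S), yc (local_step \<eta>x \<eta>y 3 3 a G S))
    = (xc S, yc S) + a *\<^sub>R scale (dx S, dy S)"
  "(dx (local_step \<eta>x \<eta>y 3 3 a G S), dy (local_step \<eta>x \<eta>y 3 3 a G S))
    = (1 - 3 * a) *\<^sub>R (dx S, dy S) + (3 * a) *\<^sub>R G ((xc S, yc S) + a *\<^sub>R scale (dx S, dy S))"
  by (simp_all add: local_step_def Let_def scale_def prod_eq_iff)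

lemma pos_Suc:
    "pos (Suc t) i \<omega> = (if \<tau> dvd Suc t then avg n (\<lambda>i. loc_pos t i \<omega>) else loc_pos t i \<omega>)"
  and dir_Suc:
    "dir (Suc t) i \<omega> = (if \<tau> dvd Suc t then avg n (\<lambda>i. loc_dir t i \<omega>) else loc_dir t i \<omega>)"
proof -
  define S' where "S' = (\<lambda>i. local_step \<eta>x \<eta>y 3 3 a (\<lambda>z. g i z (\<xi> i (Suc t) \<omega>)) (state t i \<omega>))"
  have st: "state (Suc t) i \<omega> = (if \<tau> dvd Suc t then server_average n S' else S' i)" for i
    by (simp add: state_def S'_def)
  have 1: "(xc (S' i), yc (S' i)) = loc_pos t i \<omega>" for i
    unfolding S'_def local_step_eq loc_pos_def pos_def dir_def ..
  have 2: "(dx (S' i), dy (S' i)) = loc_dir t i \<omega>" for i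
    unfolding S'_def local_step_eq loc_dir_def loc_grad_def loc_noise_def noise_def
      loc_pos_def pos_def dir_def by simp
  show "pos (Suc t) i \<omega> = (if \<tau> dvd Suc t then avg n (\<lambda>i. loc_pos t i \<omega>) else loc_pos t i \<omega>)"
    using 1 by (simp add: pos_def st server_average_def avg_Pair[symmetric])
  show "dir (Suc t) i \<omega> = (if \<tau> dvd Suc t then avg n (\<lambda>i. loc_dir t i \<omega>) else loc_dir t i \<omega>)"
    using 2 by (simp add: dir_def st server_average_def avg_Pair[symmetric])
qed

definition past :: "nat \<Rightarrow> (nat \<times> nat) set" where
  "past t = {..<n} \<times> {..t}"

lemma past: "past t \<subseteq> {..<n} \<times> UNIV" "(i, Suc t) \<notin> past t"
    "i < n \<Longrightarrow> insert (i, Suc t) (past t) \<subseteq> past (Suc t)" "past t \<subseteq> past (Suc t)"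
  by (auto simp: past_def)

lemma scale_measurable [measurable]: "scale \<in> borel_measurable borel"
  by (intro borel_measurable_continuous_onI linear_continuous_on scale_bounded_linear)

text \<open>The off-by-one on which independence rests: the position after the step is moved by the
  old direction and so depends on samples up to time \<open>t\<close> only; the samples of time
  \<open>Suc t\<close> enter through the new direction.\<close>

lemma loc_measurable:
  assumes p: "\<And>i. i < n \<Longrightarrow> pos t i \<in> borel_measurable (hist (past t))"
    and d: "\<And>i. i < n \<Longrightarrow> dir t i \<in> borel_measurable (hist (past t))" and i: "i < n"
  shows "loc_pos t i \<in> borel_measurable (hist (past t))"
    and "loc_noise t i \<in> borel_measurable (hist (past (Suc t)))"
    and "loc_dir t i \<in> borel_measurable (hist (past (Suc t)))"
proof -
  note [measurable] = p[OF i] d[OF i] client_gradient_measurable[OF i]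
  show lp: "loc_pos t i \<in> borel_measurable (hist (past t))"
    unfolding loc_pos_def by measurable
  have "loc_noise t i \<in> borel_measurable (hist (insert (i, Suc t) (past t)))"
    unfolding loc_noise_def
    by (rule noise_measurable_hist[OF bv past(1) i past(2) lp]) measurable
  then show ln: "loc_noise t i \<in> borel_measurable (hist (past (Suc t)))"
    by (rule measurable_hist_mono[OF _ past(3)[OF i] past(1)])
  note [measurable] = ln measurable_hist_mono[OF lp past(4) past(1)]
    measurable_hist_mono[OF d[OF i] past(4) past(1)]
  show "loc_dir t i \<in> borel_measurable (hist (past (Suc t)))"
    unfolding loc_dir_def loc_grad_def by measurable
qed

lemma pos_dir_measurable:
  "i < n \<Longrightarrow> pos t i \<in> borel_measurable (hist (past t)) \<and> dir t i \<in> borel_measurable (hist (past t))"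
proof (induction t arbitrary: i)
  case 0
  have "noise f g i 0 (\<lambda>_. (x0, y0)) \<in> borel_measurable (hist (insert (i, 0) {}))"
    using 0 by (intro noise_measurable_hist[OF bv]) (auto intro: client_gradient_measurable)
  then have [measurable]: "noise f g i 0 (\<lambda>_. (x0, y0)) \<in> borel_measurable (hist (past 0))"
    using 0 by (rule_tac measurable_hist_mono) (auto simp: past_def)
  show ?case by (simp add: pos_0[abs_def] dir_0[abs_def])
next
  case (Suc t)
  note loc = loc_measurable[OF conjunct1[OF Suc.IH] conjunct2[OF Suc.IH]]
  have [measurable]: "loc_pos t i \<in> borel_measurable (hist (past (Suc t)))" if "i < n" for i
    by (rule measurable_hist_mono[OF loc(1) past(4) past(1)]) (use that in auto)
  then show ?case
    using Suc.prems loc(3) unfolding pos_Suc[abs_def] dir_Suc[abs_def]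
    by (cases "\<tau> dvd Suc t") (auto intro!: borel_measurable_avg)
qed

lemmas pos_measurable = conjunct1[OF pos_dir_measurable]
  and dir_measurable = conjunct2[OF pos_dir_measurable]
lemmas loc_pos_measurable = loc_measurable(1)[OF pos_measurable dir_measurable]
  and loc_noise_measurable = loc_measurable(2)[OF pos_measurable dir_measurable]

lemma loc_noise_sq_int: "i < n \<Longrightarrow> sq_int M (loc_noise t i)"
  and loc_noise_second_moment: "i < n \<Longrightarrow> (\<integral>\<omega>. (norm (loc_noise t i \<omega>))\<^sup>2 \<partial>M) \<le> \<sigma>\<^sup>2"
  unfolding loc_noise_def
  using noise_second_moment[OF bv past(1) _ past(2) loc_pos_measurable client_gradient_measurable]
  by auto

lemma loc_sq_int:
  assumes p: "sq_int M (pos t i)" and d: "sq_int M (dir t i)" and i: "i < n"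
  shows "sq_int M (loc_pos t i)" "sq_int M (loc_grad t i)" "sq_int M (loc_dir t i)"
proof -
  show lp: "sq_int M (loc_pos t i)"
    unfolding loc_pos_def[abs_def]
    by (intro sq_int_add p sq_int_scaleR sq_int_linear[OF d] scale_bounded_linear)
  show lg: "sq_int M (loc_grad t i)"
    unfolding loc_grad_def[abs_def]
    by (intro sq_int_add loc_noise_sq_int i sq_int_Lipschitz[OF lp client_Lipschitz[OF i]])
  show "sq_int M (loc_dir t i)"
    unfolding loc_dir_def[abs_def] by (intro sq_int_add sq_int_scaleR d lg)
qed

lemma init_noise:
  assumes "i < n"
  shows "sq_int M (noise f g i 0 (\<lambda>_. (x0, y0)))"
    and "(\<integral>\<omega>. (norm (noise f g i 0 (\<lambda>_. (x0, y0)) \<omega>))\<^sup>2 \<partial>M) \<le> \<sigma>\<^sup>2"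
  by (rule noise_second_moment[OF bv, where A="{}"];
      use assms in \<open>auto intro: client_gradient_measurable\<close>)+

lemma pos_dir_sq_int: "i < n \<Longrightarrow> sq_int M (pos t i) \<and> sq_int M (dir t i)"
proof (induction t arbitrary: i)
  case 0
  then show ?case
    by (auto simp: pos_0[abs_def] dir_0[abs_def] intro!: sq_int_add init_noise sq_int_const)
next
  case (Suc t)
  note loc = loc_sq_int[OF conjunct1[OF Suc.IH] conjunct2[OF Suc.IH]]
  show ?case
    using Suc.prems loc(1,3) unfolding pos_Suc[abs_def] dir_Suc[abs_def]
    by (cases "\<tau> dvd Suc t") (auto intro!: sq_int_avg)
qed

lemmas pos_sq_int = conjunct1[OF pos_dir_sq_int]
  and dir_sq_int = conjunct2[OF pos_dir_sq_int]
lemmas loc_pos_sq_int = loc_sq_int(1)[OF pos_sq_int dir_sq_int]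
  and loc_grad_sq_int = loc_sq_int(2)[OF pos_sq_int dir_sq_int]
  and loc_dir_sq_int = loc_sq_int(3)[OF pos_sq_int dir_sq_int]

section \<open>Recursions for the client means\<close>

definition mean_pos :: "nat \<Rightarrow> 'w \<Rightarrow> 'a \<times> 'b" where
  "mean_pos t \<omega> = avg n (\<lambda>i. pos t i \<omega>)"

definition mean_dir :: "nat \<Rightarrow> 'w \<Rightarrow> 'a \<times> 'b" where
  "mean_dir t \<omega> = avg n (\<lambda>i. dir t i \<omega>)"

definition mean_noise :: "nat \<Rightarrow> 'w \<Rightarrow> 'a \<times> 'b" where
  "mean_noise t \<omega> = avg n (\<lambda>i. loc_noise t i \<omega>)"

text \<open>Averaging replaces every client value by the mean and so preserves the mean; the
  recursion is the same with and without communication.\<close>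

lemma mean_pos_Suc_avg: "mean_pos (Suc t) \<omega> = avg n (\<lambda>i. loc_pos t i \<omega>)"
  and mean_dir_Suc_avg: "mean_dir (Suc t) \<omega> = avg n (\<lambda>i. loc_dir t i \<omega>)"
  by (cases "\<tau> dvd Suc t"; simp add: mean_pos_def mean_dir_def pos_Suc dir_Suc avg_const[OF n])+

lemma mean_pos_Suc: "mean_pos (Suc t) \<omega> = mean_pos t \<omega> + a *\<^sub>R scale (mean_dir t \<omega>)"
  unfolding mean_pos_Suc_avg loc_pos_def avg_add avg_scaleR avg_linear[OF scale_linear]
  by (simp add: mean_pos_def mean_dir_def)

lemma mean_dir_Suc: "mean_dir (Suc t) \<omega>
    = (1 - 3 * a) *\<^sub>R mean_dir t \<omega> + (3 * a) *\<^sub>R avg n (\<lambda>i. loc_grad t i \<omega>)"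
  unfolding mean_dir_Suc_avg loc_dir_def avg_add avg_scaleR by (simp add: mean_dir_def)

lemma mean_sq_int:
  "sq_int M (mean_pos t)" "sq_int M (mean_dir t)" "sq_int M (mean_noise t)"
  unfolding mean_pos_def[abs_def] mean_dir_def[abs_def] mean_noise_def[abs_def]
  by (intro sq_int_avg pos_sq_int dir_sq_int loc_noise_sq_int; assumption)+

section \<open>Spread of the clients between two averagings\<close>

definition spread_pos :: "nat \<Rightarrow> 'w \<Rightarrow> real" where
  "spread_pos t \<omega> = avg n (\<lambda>i. (norm (pos t i \<omega> - mean_pos t \<omega>))\<^sup>2)"

definition spread_dir :: "nat \<Rightarrow> 'w \<Rightarrow> real" where
  "spread_dir t \<omega> = avg n (\<lambda>i. (norm (dir t i \<omega> - mean_dir t \<omega>))\<^sup>2)"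

text \<open>Measured before a possible averaging, because this is where the clients evaluate their
  gradients.\<close>

definition loc_spread :: "nat \<Rightarrow> 'w \<Rightarrow> real" where
  "loc_spread t \<omega> = avg n (\<lambda>i. (norm (loc_pos t i \<omega> - mean_pos (Suc t) \<omega>))\<^sup>2)"

lemma spread_integrable:
  "integrable M (spread_pos t)" "integrable M (spread_dir t)" "integrable M (loc_spread t)"
  unfolding spread_pos_def[abs_def] spread_dir_def[abs_def] loc_spread_def[abs_def]
  by (intro integrable_avg sq_int_integrable sq_int_diff mean_sq_int pos_sq_int dir_sq_int
      loc_pos_sq_int; assumption)+

lemma loc_spread_le:
  assumes s: "s > 0"
  shows "loc_spread t \<omega> \<le> (1 + 1 / s) * spread_pos t \<omega> + (1 + s) * (a\<^sup>2 * \<eta>y\<^sup>2 * spread_dir t \<omega>)"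
proof -
  have "loc_spread t \<omega> \<le> avg n (\<lambda>i. (1 + 1 / s) * (norm (pos t i \<omega> - mean_pos t \<omega>))\<^sup>2
      + (1 + s) * (a\<^sup>2 * \<eta>y\<^sup>2 * (norm (dir t i \<omega> - mean_dir t \<omega>))\<^sup>2))"
    unfolding loc_spread_def
  proof (rule avg_mono)
    fix i
    let ?u = "pos t i \<omega> - mean_pos t \<omega>" and ?v = "dir t i \<omega> - mean_dir t \<omega>"
    have "loc_pos t i \<omega> - mean_pos (Suc t) \<omega> = ?u + a *\<^sub>R scale ?v"
      by (simp add: loc_pos_def mean_pos_Suc linear_diff[OF scale_linear] scaleR_diff_right)
    then have "(norm (loc_pos t i \<omega> - mean_pos (Suc t) \<omega>))\<^sup>2
        \<le> (1 + 1 / s) * (norm ?u)\<^sup>2 + (1 + s) * (norm (a *\<^sub>R scale ?v))\<^sup>2"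
      using norm_add_sq_le[of "1 / s" ?u "a *\<^sub>R scale ?v"] s by simp
    also have "\<dots> \<le> (1 + 1 / s) * (norm ?u)\<^sup>2 + (1 + s) * (a\<^sup>2 * \<eta>y\<^sup>2 * (norm ?v)\<^sup>2)"
    proof (intro add_left_mono mult_left_mono)
      have "(norm (a *\<^sub>R scale ?v))\<^sup>2 = a\<^sup>2 * (norm (scale ?v))\<^sup>2"
        by (simp add: power_mult_distrib)
      also have "\<dots> \<le> a\<^sup>2 * (\<eta>y\<^sup>2 * (norm ?v)\<^sup>2)"
        by (intro mult_left_mono norm_scale_sq_le) simp
      finally show "(norm (a *\<^sub>R scale ?v))\<^sup>2 \<le> a\<^sup>2 * \<eta>y\<^sup>2 * (norm ?v)\<^sup>2" by (simp add: mult.assoc)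
    qed (use s in simp)
    finally show "(norm (loc_pos t i \<omega> - mean_pos (Suc t) \<omega>))\<^sup>2
        \<le> (1 + 1 / s) * (norm ?u)\<^sup>2 + (1 + s) * (a\<^sup>2 * \<eta>y\<^sup>2 * (norm ?v)\<^sup>2)" .
  qed
  then show ?thesis by (simp only: avg_add avg_mult spread_pos_def spread_dir_def)
qed

text \<open>Replacing the mean by \<open>gradient F m\<close> can only increase the deviation, which
  then splits into noise, the Lipschitz change from \<open>m\<close> to \<open>p i\<close>, and
  heterogeneity at the common point \<open>m\<close>.\<close>

lemma client_deviation_le:
  assumes "\<And>i. i < n \<Longrightarrow> (norm (gradient (f i) (p i) - gradient (f i) m))\<^sup>2 \<le> L\<^sup>2 * (norm (p i - m))\<^sup>2"
  shows "avg n (\<lambda>i. (norm (N i + gradient (f i) (p i)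
      - avg n (\<lambda>i. N i + gradient (f i) (p i))))\<^sup>2)
    \<le> 3 * (avg n (\<lambda>i. (norm (N i))\<^sup>2) + L\<^sup>2 * avg n (\<lambda>i. (norm (p i - m))\<^sup>2) + Z)"
proof -
  let ?G = "\<lambda>i. N i + gradient (f i) (p i)"
  have "avg n (\<lambda>i. (norm (?G i - avg n ?G))\<^sup>2) \<le> avg n (\<lambda>i. (norm (?G i - gradient F m))\<^sup>2)"
    by (rule avg_deviation_le[OF n])
  also have "\<dots> \<le> avg n (\<lambda>i. (3 * (norm (N i))\<^sup>2 + (3 * L\<^sup>2) * (norm (p i - m))\<^sup>2)
      + 3 * (norm (gradient (f i) m - gradient F m))\<^sup>2)"
  proof (rule avg_mono)
    fix i assume "i < n"
    have "(norm (?G i - gradient F m))\<^sup>2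
        \<le> 3 * (norm (N i))\<^sup>2 + 3 * (norm (gradient (f i) (p i) - gradient (f i) m))\<^sup>2
          + 3 * (norm (gradient (f i) m - gradient F m))\<^sup>2"
      using norm_add_sq_le3[of "N i" "gradient (f i) (p i) - gradient (f i) m"
          "gradient (f i) m - gradient F m"] by (simp add: algebra_simps)
    then show "(norm (?G i - gradient F m))\<^sup>2
        \<le> (3 * (norm (N i))\<^sup>2 + (3 * L\<^sup>2) * (norm (p i - m))\<^sup>2)
          + 3 * (norm (gradient (f i) m - gradient F m))\<^sup>2"
      using assms[OF \<open>i < n\<close>] by simp
  qed
  also have "\<dots> \<le> 3 * (avg n (\<lambda>i. (norm (N i))\<^sup>2) + L\<^sup>2 * avg n (\<lambda>i. (norm (p i - m))\<^sup>2) + Z)"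
    unfolding avg_add avg_mult using het[of m] by simp
  finally show ?thesis .
qed

lemma client_Lipschitz_sq:
  "i < n \<Longrightarrow> (norm (gradient (f i) z - gradient (f i) z'))\<^sup>2 \<le> L\<^sup>2 * (norm (z - z'))\<^sup>2"
  using power_mono[OF client_Lipschitz[of i z z'], of 2] by (simp add: power_mult_distrib)

lemma spread_dir_Suc_le:
  assumes "\<not> \<tau> dvd Suc t"
  shows "spread_dir (Suc t) \<omega> \<le> (1 - 3 * a) * spread_dir t \<omega>
    + 3 * a * (3 * (avg n (\<lambda>i. (norm (loc_noise t i \<omega>))\<^sup>2) + L\<^sup>2 * loc_spread t \<omega> + Z))"
proof -
  let ?G = "\<lambda>i. loc_grad t i \<omega>"
  have "spread_dir (Suc t) \<omega> \<le> avg n (\<lambda>i. (1 - 3 * a) * (norm (dir t i \<omega> - mean_dir t \<omega>))\<^sup>2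
      + (3 * a) * (norm (?G i - avg n ?G))\<^sup>2)"
    unfolding spread_dir_def
  proof (rule avg_mono)
    fix i
    have "dir (Suc t) i \<omega> - mean_dir (Suc t) \<omega>
        = (1 - 3 * a) *\<^sub>R (dir t i \<omega> - mean_dir t \<omega>) + (3 * a) *\<^sub>R (?G i - avg n ?G)"
      using assms by (simp add: dir_Suc loc_dir_def mean_dir_Suc scaleR_diff_right)
    then show "(norm (dir (Suc t) i \<omega> - mean_dir (Suc t) \<omega>))\<^sup>2
        \<le> (1 - 3 * a) * (norm (dir t i \<omega> - mean_dir t \<omega>))\<^sup>2 + (3 * a) * (norm (?G i - avg n ?G))\<^sup>2"
      using a by (simp only:) (rule norm_convex_sq_le; simp)
  qed
  also have "\<dots> = (1 - 3 * a) * spread_dir t \<omega> + 3 * a * avg n (\<lambda>i. (norm (?G i - avg n ?G))\<^sup>2)"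
    by (simp only: avg_add avg_mult spread_dir_def)
  also have "\<dots> \<le> (1 - 3 * a) * spread_dir t \<omega>
      + 3 * a * (3 * (avg n (\<lambda>i. (norm (loc_noise t i \<omega>))\<^sup>2) + L\<^sup>2 * loc_spread t \<omega> + Z))"
    unfolding loc_grad_def loc_spread_def using a
    by (intro add_left_mono mult_left_mono client_deviation_le client_Lipschitz_sq) auto
  finally show ?thesis .
qed

text \<open>The level at which the direction spread sustains itself: it solves
  \<open>3 * (\<sigma>\<^sup>2 + B / 6 + Z) = B\<close>, where \<open>B / 6\<close> is the allowance
  for drift.\<close>

definition B :: real where "B = 6 * (\<sigma>\<^sup>2 + Z)"

lemma Z_nonneg: "Z \<ge> 0"
proof (rule order_trans[OF _ het])
  show "0 \<le> avg n (\<lambda>i. (norm (gradient (f i) 0 - gradient F 0))\<^sup>2)"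
    by (intro avg_nonneg) simp
qed

lemma B_nonneg: "B \<ge> 0" using Z_nonneg by (simp add: B_def)

lemma mean_loc_noise_le: "(\<integral>\<omega>. avg n (\<lambda>i. (norm (loc_noise t i \<omega>))\<^sup>2) \<partial>M) \<le> \<sigma>\<^sup>2"
  by (subst integral_avg)
    (auto intro!: avg_le_const n loc_noise_second_moment sq_int_integrable loc_noise_sq_int)

text \<open>Bounds the squared displacement spread that one step creates from a direction spread
  \<open>B\<close>.\<close>

definition C :: real where "C = a\<^sup>2 * \<eta>y\<^sup>2 * B"

lemma C_nonneg: "C \<ge> 0" using B_nonneg by (simp add: C_def)

lemma loc_spread_expectation:
  assumes "expectation (spread_pos t) \<le> 2 * C * (real m)\<^sup>2" "expectation (spread_dir t) \<le> B"
  shows "expectation (loc_spread t) \<le> 2 * C * (real (Suc m))\<^sup>2"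
proof -
  \<comment> \<open>\<open>s = m\<close> keeps the growth quadratic: the bracket becomes
    \<open>(2 * m + 1) * (m + 1)\<close>, at most \<open>2 * (m + 1) ^ 2\<close>. At
    \<open>m = 0\<close> the positions coincide in mean square and \<open>s = 1\<close> avoids a
    division by zero.\<close>
  define s where "s = real (max 1 m)"
  have s: "s > 0" by (simp add: s_def)
  have "expectation (loc_spread t) \<le> expectation (\<lambda>\<omega>. (1 + 1 / s) * spread_pos t \<omega>
      + (1 + s) * (a\<^sup>2 * \<eta>y\<^sup>2 * spread_dir t \<omega>))"
    by (intro integral_mono loc_spread_le s Bochner_Integration.integrable_add
        integrable_mult_right spread_integrable)
  also have "\<dots> = (1 + 1 / s) * expectation (spread_pos t)
      + (1 + s) * (a\<^sup>2 * \<eta>y\<^sup>2 * expectation (spread_dir t))"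
    using spread_integrable by simp
  also have "\<dots> \<le> (1 + 1 / s) * (2 * C * (real m)\<^sup>2) + (1 + s) * (a\<^sup>2 * \<eta>y\<^sup>2 * B)"
    using assms s by (intro add_mono mult_left_mono) auto
  also have "\<dots> = C * (2 * (1 + 1 / s) * (real m)\<^sup>2 + (1 + s))"
    by (simp add: C_def algebra_simps)
  also have "\<dots> \<le> C * (2 * (real (Suc m))\<^sup>2)"
  proof (rule mult_left_mono[OF _ C_nonneg])
    show "2 * (1 + 1 / s) * (real m)\<^sup>2 + (1 + s) \<le> 2 * (real (Suc m))\<^sup>2"
    proof (cases "m = 0")
      case False
      then have "s = real m" by (simp add: s_def)
      then show ?thesis using False by (simp add: field_simps power2_eq_square)
    qed (simp add: s_def)
  qed
  finally show ?thesis by simp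
qed

text \<open>The limits on \<open>L * \<eta>y\<close> and \<open>a * \<tau>\<close> keep the
  contribution of the position spread to the direction spread within the allowance in
  \<open>B\<close>.\<close>

lemma drift: "L\<^sup>2 * (2 * C * (real m)\<^sup>2) \<le> B / 6" if "m \<le> \<tau>"
proof -
  have "(6 * L * \<eta>y)\<^sup>2 \<le> 1" using \<eta>y L \<eta>y_pos by (intro power_le_one) auto
  moreover have "(a * real m)\<^sup>2 \<le> 1"
  proof (rule power_le_one)
    have "a * real m \<le> a * real \<tau>" using a that by (intro mult_left_mono) auto
    then show "a * real m \<le> 1" using a by linarith
  qed (use a in simp)
  ultimately have "(6 * L * \<eta>y)\<^sup>2 * (a * real m)\<^sup>2 \<le> 1 * 1"
    by (intro mult_mono) auto
  then have "(6 * L * \<eta>y)\<^sup>2 * (a * real m)\<^sup>2 * B \<le> B"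
    using mult_right_mono[OF _ B_nonneg] by fastforce
  then have "36 * (L\<^sup>2 * (C * (real m)\<^sup>2)) \<le> B"
    by (simp add: C_def power_mult_distrib mult_ac)
  moreover have "0 \<le> L\<^sup>2 * (C * (real m)\<^sup>2)" using C_nonneg by simp
  ultimately show ?thesis by simp
qed

text \<open>The two bounds need each other and are proved together: directions push the positions
  apart, and separated positions give different gradients. \<open>t mod \<tau>\<close> counts the
  steps since the last averaging.\<close>

lemma spread_expectation:
  "expectation (spread_pos t) \<le> 2 * C * (real (t mod \<tau>))\<^sup>2 \<and> expectation (spread_dir t) \<le> B"
proof (induction t)
  case 0
  have "spread_pos 0 \<omega> = 0" for \<omega>
    by (simp add: spread_pos_def mean_pos_def pos_0 avg_const[OF n])
  moreover have "expectation (spread_dir 0) \<le> 3 * (\<sigma>\<^sup>2 + Z)"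
  proof -
    let ?N = "\<lambda>i. noise f g i 0 (\<lambda>_. (x0, y0))"
    have "spread_dir 0 \<omega> \<le> 3 * (avg n (\<lambda>i. (norm (?N i \<omega>))\<^sup>2) + Z)" for \<omega>
      using client_deviation_le[of "\<lambda>_. (x0, y0)" "(x0, y0)" "\<lambda>i. ?N i \<omega>"]
      by (simp add: spread_dir_def mean_dir_def dir_0 avg_const[OF n])
    then have "expectation (spread_dir 0) \<le> expectation (\<lambda>\<omega>. 3 * (avg n (\<lambda>i. (norm (?N i \<omega>))\<^sup>2) + Z))"
      by (intro integral_mono spread_integrable integrable_mult_right
          Bochner_Integration.integrable_add integrable_avg sq_int_integrable init_noise) auto
    also have "\<dots> = 3 * (avg n (\<lambda>i. \<integral>\<omega>. (norm (?N i \<omega>))\<^sup>2 \<partial>M) + Z)"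
      using sq_int_integrable[OF init_noise(1)]
      by (simp add: integrable_avg integral_avg prob_space)
    also have "\<dots> \<le> 3 * (\<sigma>\<^sup>2 + Z)"
      using avg_le_const[OF n init_noise(2)] by simp
    finally show ?thesis .
  qed
  moreover have "3 * (\<sigma>\<^sup>2 + Z) \<le> B"
    unfolding B_def using Z_nonneg by (intro mult_right_mono) auto
  ultimately show ?case by simp
next
  case (Suc t)
  note IH = conjunct1[OF Suc.IH] conjunct2[OF Suc.IH]
  note ls = loc_spread_expectation[OF IH]
  show ?case
  proof (cases "\<tau> dvd Suc t")
    case True
    then have "spread_pos (Suc t) \<omega> = 0" "spread_dir (Suc t) \<omega> = 0" for \<omega>
      by (simp_all add: spread_pos_def spread_dir_def mean_pos_Suc_avg mean_dir_Suc_avg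
          pos_Suc dir_Suc avg_const[OF n])
    then show ?thesis using C_nonneg B_nonneg by simp
  next
    case False
    then have mod: "Suc t mod \<tau> = Suc (t mod \<tau>)"
      by (auto simp: mod_Suc dvd_eq_mod_eq_0)
    have "spread_pos (Suc t) = loc_spread t"
      using False by (simp add: fun_eq_iff spread_pos_def loc_spread_def pos_Suc)
    then have 1: "expectation (spread_pos (Suc t)) \<le> 2 * C * (real (Suc t mod \<tau>))\<^sup>2"
      using ls mod by simp
    have "Suc t mod \<tau> \<le> \<tau>" using \<tau> by (simp add: less_imp_le)
    with ls drift have "L\<^sup>2 * expectation (loc_spread t) \<le> B / 6"
      unfolding mod by (meson mult_left_mono order_trans zero_le_power2)
    then have b: "3 * (\<sigma>\<^sup>2 + L\<^sup>2 * expectation (loc_spread t) + Z) \<le> B"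
      by (simp add: B_def)
    have "expectation (spread_dir (Suc t)) \<le> expectation (\<lambda>\<omega>. (1 - 3 * a) * spread_dir t \<omega>
        + 3 * a * (3 * (avg n (\<lambda>i. (norm (loc_noise t i \<omega>))\<^sup>2) + L\<^sup>2 * loc_spread t \<omega> + Z)))"
      using False
      by (intro integral_mono spread_dir_Suc_le spread_integrable integrable_mult_right
          Bochner_Integration.integrable_add integrable_avg sq_int_integrable loc_noise_sq_int) auto
    also have "\<dots> = (1 - 3 * a) * expectation (spread_dir t)
        + 3 * a * (3 * ((\<integral>\<omega>. avg n (\<lambda>i. (norm (loc_noise t i \<omega>))\<^sup>2) \<partial>M)
          + L\<^sup>2 * expectation (loc_spread t) + Z))"
      using spread_integrable sq_int_integrable[OF loc_noise_sq_int]
      by (simp add: integrable_avg prob_space)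
    also have "\<dots> \<le> (1 - 3 * a) * B
        + 3 * a * (3 * (\<sigma>\<^sup>2 + L\<^sup>2 * expectation (loc_spread t) + Z))"
      using a IH(2) mean_loc_noise_le[of t] by (intro add_mono mult_left_mono) auto
    also have "\<dots> \<le> (1 - 3 * a) * B + 3 * a * B"
      using a b by (intro add_mono mult_left_mono) auto
    finally have "expectation (spread_dir (Suc t)) \<le> B" by (simp add: algebra_simps)
    with 1 show ?thesis ..
  qed
qed

lemma loc_spread_bound: "expectation (loc_spread t) \<le> 2 * C * (real \<tau>)\<^sup>2"
proof -
  note sp = spread_expectation[of t]
  have "Suc (t mod \<tau>) \<le> \<tau>" using \<tau> by (simp add: Suc_leI)
  then have "(real (Suc (t mod \<tau>)))\<^sup>2 \<le> (real \<tau>)\<^sup>2" by (intro power_mono) auto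
  then have "2 * C * (real (Suc (t mod \<tau>)))\<^sup>2 \<le> 2 * C * (real \<tau>)\<^sup>2"
    using C_nonneg by (intro mult_left_mono) auto
  with loc_spread_expectation[OF conjunct1[OF sp] conjunct2[OF sp]] show ?thesis by linarith
qed

end

section \<open>Expected decrease\<close>

text \<open>Passes from a bound on the mean squared gradient to one on the mean norm, with the
  random output time as second coordinate of the product space.\<close>

lemma accurate_outputI:
  fixes X :: "nat \<Rightarrow> 'w \<Rightarrow> 'a::euclidean_space"
  assumes M: "prob_space M" and q: "quad_bound k \<Phi> (gradient \<Phi>)" and k: "k > 0"
    and T: "T \<ge> 1" and \<epsilon>: "\<epsilon> > 0" and X: "\<And>t. X t \<in> borel_measurable M"
    and int: "\<And>t. integrable M (\<lambda>\<omega>. (norm (gradient \<Phi> (X t \<omega>)))\<^sup>2)"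
    and le: "(\<Sum>t<T. \<integral>\<omega>. (norm (gradient \<Phi> (X t \<omega>)))\<^sup>2 \<partial>M) \<le> real T * \<epsilon>\<^sup>2"
  shows "accurate_output M \<Phi> T X \<epsilon>"
proof -
  interpret prob_space M by (rule M)
  let ?U = "measure_pmf (pmf_of_set {..<T})"
  interpret pair_sigma_finite M ?U by unfold_locales
  let ?e = "\<lambda>t \<omega>. norm (gradient \<Phi> (X t \<omega>))"
  note [measurable] = X borel_measurable_continuous_onI[OF quad_bound_continuous(2)[OF q k]]
  \<comment> \<open>AM-GM, in place of Jensen's inequality for the square root\<close>
  have am: "?e t \<omega> \<le> (?e t \<omega>)\<^sup>2 / (2 * \<epsilon>) + \<epsilon> / 2" for t \<omega>
  proof -
    have "0 \<le> (?e t \<omega> - \<epsilon>)\<^sup>2" by simp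
    then show ?thesis using \<epsilon> by (simp add: field_simps power2_eq_square)
  qed
  have inte: "integrable M (?e t)" for t
  proof (rule Bochner_Integration.integrable_bound)
    show "integrable M (\<lambda>\<omega>. (?e t \<omega>)\<^sup>2 / (2 * \<epsilon>) + \<epsilon> / 2)" using int by simp
    show "AE \<omega> in M. norm (?e t \<omega>) \<le> norm ((?e t \<omega>)\<^sup>2 / (2 * \<epsilon>) + \<epsilon> / 2)"
      using am \<epsilon> by (auto intro!: AE_I2 order_trans[OF am])
  qed measurable
  have "(\<Sum>t<T. \<integral>\<omega>. ?e t \<omega> \<partial>M) \<le> (\<Sum>t<T. \<integral>\<omega>. (?e t \<omega>)\<^sup>2 / (2 * \<epsilon>) + \<epsilon> / 2 \<partial>M)"
    using int by (intro sum_mono integral_mono am inte) auto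
  also have "\<dots> = (\<Sum>t<T. \<integral>\<omega>. (?e t \<omega>)\<^sup>2 \<partial>M) / (2 * \<epsilon>) + real T * (\<epsilon> / 2)"
    using int by (simp add: sum.distrib sum_divide_distrib prob_space)
  also have "\<dots> \<le> real T * \<epsilon>\<^sup>2 / (2 * \<epsilon>) + real T * (\<epsilon> / 2)"
    using le \<epsilon> by (intro add_right_mono divide_right_mono) auto
  also have "\<dots> = real T * \<epsilon>" using \<epsilon> by (simp add: power2_eq_square)
  finally have bound: "(\<Sum>t<T. \<integral>\<omega>. ?e t \<omega> \<partial>M) / real T \<le> \<epsilon>"
    using T by (simp add: field_simps)
  have nn: "0 \<le> (\<Sum>t<T. \<integral>\<omega>. ?e t \<omega> \<partial>M)" by (intro sum_nonneg integral_nonneg) simp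
  let ?err = "\<lambda>(\<omega>, t). ?e t \<omega>"
  have meas: "?err \<in> borel_measurable (M \<Otimes>\<^sub>M ?U)"
  proof -
    \<comment> \<open>The time coordinate is discrete, so joint measurability reduces to that of
      each fixed \<open>t\<close>.\<close>
    have [measurable]: "snd \<in> measurable (M \<Otimes>\<^sub>M ?U) (count_space UNIV)"
      using measurable_snd[of M ?U] by (simp cong: measurable_cong_sets)
    have "(\<lambda>p. ?e (snd p) (fst p)) \<in> borel_measurable (M \<Otimes>\<^sub>M ?U)"
      by (rule measurable_compose_countable[where f="\<lambda>t p. ?e t (fst p)" and g=snd]) measurable
    then show ?thesis by (simp add: case_prod_beta')
  qed
  \<comment> \<open>Going through the nonnegative integral yields joint integrability and the value
    at once.\<close>
  have "has_bochner_integral (M \<Otimes>\<^sub>M ?U) ?err ((\<Sum>t<T. \<integral>\<omega>. ?e t \<omega> \<partial>M) / real T)"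
  proof (rule has_bochner_integral_nn_integral[OF meas])
    show "AE p in M \<Otimes>\<^sub>M ?U. 0 \<le> ?err p" by (rule AE_I2) auto
    show "0 \<le> (\<Sum>t<T. \<integral>\<omega>. ?e t \<omega> \<partial>M) / real T" using nn by simp
    have "(\<integral>\<^sup>+p. ?err p \<partial>(M \<Otimes>\<^sub>M ?U)) = (\<integral>\<^sup>+t. \<integral>\<^sup>+\<omega>. ?e t \<omega> \<partial>M \<partial>?U)"
      using nn_integral_snd[of "\<lambda>p. ennreal (?err p)"] meas by simp
    also have "\<dots> = (\<integral>\<^sup>+t. ennreal (\<integral>\<omega>. ?e t \<omega> \<partial>M) \<partial>?U)"
      using inte by (intro nn_integral_cong nn_integral_eq_integral) auto
    also have "\<dots> = (\<Sum>t<T. ennreal (\<integral>\<omega>. ?e t \<omega> \<partial>M)) / real T"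
      using T by (subst nn_integral_pmf_of_set) (auto simp: lessThan_empty_iff ennreal_of_nat_eq_real_of_nat)
    also have "\<dots> = ennreal ((\<Sum>t<T. \<integral>\<omega>. ?e t \<omega> \<partial>M) / real T)"
      using T nn by (simp add: divide_ennreal sum_ennreal)
    finally show "(\<integral>\<^sup>+p. ?err p \<partial>(M \<Otimes>\<^sub>M ?U)) = ennreal ((\<Sum>t<T. \<integral>\<omega>. ?e t \<omega> \<partial>M) / real T)" .
  qed
  moreover have "\<Phi> differentiable at x" for x
    using quad_bound_GDERIV[OF q] by (auto simp: gderiv_def differentiable_def)
  ultimately show ?thesis
    using bound by (simp add: accurate_output_def has_bochner_integral_iff)
qed

context local_sgda
begin

section \<open>The momentum error and the Lyapunov recursion\<close>

definition err :: "nat \<Rightarrow> 'w \<Rightarrow> 'a \<times> 'b" where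
  "err t \<omega> = mean_dir t \<omega> - gradient F (mean_pos t \<omega>)"

text \<open>The part of \<open>err (Suc t)\<close> that does not depend on the samples of time \<open>Suc t\<close>.\<close>

definition drift_err :: "nat \<Rightarrow> 'w \<Rightarrow> 'a \<times> 'b" where
  "drift_err t \<omega> =
    (1 - 3 * a) *\<^sub>R (err t \<omega> + (gradient F (mean_pos t \<omega>) - gradient F (mean_pos (Suc t) \<omega>)))
    + (3 * a) *\<^sub>R (avg n (\<lambda>i. gradient (f i) (loc_pos t i \<omega>)) - gradient F (mean_pos (Suc t) \<omega>))"

lemma err_Suc: "err (Suc t) \<omega> = drift_err t \<omega> + (3 * a) *\<^sub>R mean_noise t \<omega>"
  unfolding err_def drift_err_def mean_dir_Suc mean_noise_def loc_grad_def avg_add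
  by (simp add: algebra_simps)

lemma drift_err_le:
  "(norm (drift_err t \<omega>))\<^sup>2 \<le> (1 - 3 * a / 2) * (norm (err t \<omega>))\<^sup>2
    + 2 / 3 * L\<^sup>2 * a * (norm (scale (mean_dir t \<omega>)))\<^sup>2 + 3 * a * L\<^sup>2 * loc_spread t \<omega>"
  unfolding drift_err_def
proof (rule error_step)
  have "(norm (gradient F (mean_pos t \<omega>) - gradient F (mean_pos (Suc t) \<omega>)))\<^sup>2
      \<le> (L * norm (mean_pos t \<omega> - mean_pos (Suc t) \<omega>))\<^sup>2"
    by (intro power_mono F_Lipschitz) simp
  then show "(norm (gradient F (mean_pos t \<omega>) - gradient F (mean_pos (Suc t) \<omega>)))\<^sup>2
      \<le> L\<^sup>2 * (a\<^sup>2 * (norm (scale (mean_dir t \<omega>)))\<^sup>2)"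
    by (simp add: mean_pos_Suc power_mult_distrib)
  have "(norm (avg n (\<lambda>i. gradient (f i) (loc_pos t i \<omega>)) - gradient F (mean_pos (Suc t) \<omega>)))\<^sup>2
      \<le> avg n (\<lambda>i. (norm (gradient (f i) (loc_pos t i \<omega>) - gradient (f i) (mean_pos (Suc t) \<omega>)))\<^sup>2)"
    unfolding gradient_F avg_diff[symmetric] by (rule norm_avg_sq_le[OF n])
  also have "\<dots> \<le> avg n (\<lambda>i. L\<^sup>2 * (norm (loc_pos t i \<omega> - mean_pos (Suc t) \<omega>))\<^sup>2)"
    by (intro avg_mono client_Lipschitz_sq)
  finally show "(norm (avg n (\<lambda>i. gradient (f i) (loc_pos t i \<omega>)) - gradient F (mean_pos (Suc t) \<omega>)))\<^sup>2
      \<le> L\<^sup>2 * loc_spread t \<omega>"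
    by (simp only: avg_mult loc_spread_def)
qed simp

lemma F_gradient_measurable: "gradient F \<in> borel_measurable borel"
  using F_Lipschitz L
  by (intro borel_measurable_continuous_onI lipschitz_on_continuous_on[of L])
    (auto simp: lipschitz_on_def dist_norm)

lemma drift_err_measurable: "drift_err t \<in> borel_measurable (hist (past t))"
proof -
  have [measurable]: "mean_pos t \<in> borel_measurable (hist (past t))"
      "mean_dir t \<in> borel_measurable (hist (past t))"
    unfolding mean_pos_def[abs_def] mean_dir_def[abs_def]
    by (intro borel_measurable_avg pos_measurable dir_measurable; assumption)+
  have [measurable]: "mean_pos (Suc t) \<in> borel_measurable (hist (past t))"
    unfolding mean_pos_Suc[abs_def] by measurable
  have [measurable]: "(\<lambda>\<omega>. avg n (\<lambda>i. gradient (f i) (loc_pos t i \<omega>))) \<in> borel_measurable (hist (past t))"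
    by (intro borel_measurable_avg measurable_compose[OF loc_pos_measurable client_gradient_measurable])
  note [measurable] = F_gradient_measurable
  show ?thesis unfolding drift_err_def[abs_def] err_def[abs_def] by measurable
qed

lemma err_sq_int: "sq_int M (err t)"
  unfolding err_def[abs_def]
  by (intro sq_int_diff mean_sq_int sq_int_Lipschitz[OF mean_sq_int(1) F_Lipschitz])

lemma drift_err_sq_int: "sq_int M (drift_err t)"
  unfolding drift_err_def[abs_def]
  by (intro sq_int_add sq_int_scaleR err_sq_int sq_int_diff sq_int_avg
      sq_int_Lipschitz[OF mean_sq_int(1) F_Lipschitz]
      sq_int_Lipschitz[OF loc_pos_sq_int client_Lipschitz])

lemma drift_err_orthogonal: "expectation (\<lambda>\<omega>. drift_err t \<omega> \<bullet> mean_noise t \<omega>) = 0"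
proof -
  have "expectation (\<lambda>\<omega>. drift_err t \<omega> \<bullet> mean_noise t \<omega>)
      = expectation (\<lambda>\<omega>. avg n (\<lambda>i. drift_err t \<omega> \<bullet> loc_noise t i \<omega>))"
    unfolding mean_noise_def inner_commute[of "drift_err t _"] avg_inner ..
  also have "\<dots> = avg n (\<lambda>i. expectation (\<lambda>\<omega>. drift_err t \<omega> \<bullet> loc_noise t i \<omega>))"
    by (intro integral_avg sq_int_inner drift_err_sq_int loc_noise_sq_int)
  also have "\<dots> = avg n (\<lambda>i. 0)"
    unfolding loc_noise_def
    by (intro avg_cong noise_orthogonal[OF bv past(1) _ past(2)] loc_pos_measurable
          client_gradient_measurable drift_err_measurable drift_err_sq_int)
  finally show ?thesis by (simp add: avg_const[OF n])
qed

lemma mean_noise_second_moment: "expectation (\<lambda>\<omega>. (norm (mean_noise t \<omega>))\<^sup>2) \<le> \<sigma>\<^sup>2 / real n"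
  unfolding mean_noise_def loc_noise_def
  by (intro noise_avg_second_moment[OF past(1) past(2)] loc_pos_measurable)

definition lyap :: "nat \<Rightarrow> 'w \<Rightarrow> real" where
  "lyap t \<omega> = \<Phi> (fst (mean_pos t \<omega>)) + gap F (mean_pos t \<omega>) / 6
    + (\<eta>x + \<eta>y) * (norm (err t \<omega>))\<^sup>2"

definition stationarity :: "nat \<Rightarrow> 'w \<Rightarrow> real" where
  "stationarity t \<omega> = (norm (gradient \<Phi> (fst (mean_pos t \<omega>))))\<^sup>2"

text \<open>The square of \<open>err (Suc t)\<close> is expanded around \<open>drift_err t\<close>.
  The cross term stays in this pointwise bound, since it vanishes only in expectation.\<close>

lemma lyap_Suc_le:
  "lyap (Suc t) \<omega> \<le> lyap t \<omega> - a * \<eta>x / 2 * stationarity t \<omega>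
    + (\<eta>x + \<eta>y) * (3 * a * L\<^sup>2 * loc_spread t \<omega>
      + 6 * a * (drift_err t \<omega> \<bullet> mean_noise t \<omega>) + 9 * a\<^sup>2 * (norm (mean_noise t \<omega>))\<^sup>2)"
proof -
  have "(norm (err (Suc t) \<omega>))\<^sup>2 = (norm (drift_err t \<omega>))\<^sup>2
      + (6 * a * (drift_err t \<omega> \<bullet> mean_noise t \<omega>) + 9 * a\<^sup>2 * (norm (mean_noise t \<omega>))\<^sup>2)"
    unfolding err_Suc
    by (simp add: power2_norm_eq_inner inner_add_left inner_add_right inner_commute)
      (simp add: power2_eq_square)
  then show ?thesis
    using lyapunov_step[OF drift_err_le[unfolded err_def] mean_pos_Suc, of t \<omega>]
    unfolding lyap_def stationarity_def by (simp add: err_def distrib_left)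
qed

lemma fst_mean_pos_sq_int: "sq_int M (\<lambda>\<omega>. fst (mean_pos t \<omega>))"
  by (rule sq_int_linear[OF mean_sq_int(1) bounded_linear_fst])

lemma \<Phi>_gradient_sq_int: "sq_int M (\<lambda>\<omega>. gradient \<Phi> (fst (mean_pos t \<omega>)))"
  by (rule sq_int_Lipschitz[OF fst_mean_pos_sq_int quad_bound_Lipschitz[OF \<Phi>_quad_bound k_pos]])

lemma stationarity_integrable: "integrable M (stationarity t)"
  unfolding stationarity_def[abs_def] by (intro sq_int_integrable \<Phi>_gradient_sq_int)

lemma lyap_integrable: "integrable M (lyap t)"
  unfolding lyap_def[abs_def]
  by (intro Bochner_Integration.integrable_add integrable_mult_right integrable_divide
      quad_bound_integrable[OF \<Phi>_quad_bound k_pos fst_mean_pos_sq_int]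
      quad_bound_integrable[OF gap_quad_bound_k k_pos mean_sq_int(1)]
      sq_int_integrable err_sq_int)

lemma expected_lyap_Suc_le:
  "expectation (lyap (Suc t)) \<le> expectation (lyap t) - a * \<eta>x / 2 * expectation (stationarity t)
    + (\<eta>x + \<eta>y) * (6 * a * L\<^sup>2 * C * (real \<tau>)\<^sup>2 + 9 * a\<^sup>2 * (\<sigma>\<^sup>2 / real n))"
proof -
  note [simp] = lyap_integrable stationarity_integrable spread_integrable
    sq_int_inner[OF drift_err_sq_int mean_sq_int(3)] sq_int_integrable[OF mean_sq_int(3)]
  have "expectation (lyap (Suc t)) \<le> expectation (\<lambda>\<omega>. lyap t \<omega> - a * \<eta>x / 2 * stationarity t \<omega>
    + (\<eta>x + \<eta>y) * (3 * a * L\<^sup>2 * loc_spread t \<omega>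
      + 6 * a * (drift_err t \<omega> \<bullet> mean_noise t \<omega>) + 9 * a\<^sup>2 * (norm (mean_noise t \<omega>))\<^sup>2))"
    by (intro integral_mono lyap_Suc_le) simp_all
  also have "\<dots> = expectation (lyap t) - a * \<eta>x / 2 * expectation (stationarity t)
      + (\<eta>x + \<eta>y) * (3 * a * L\<^sup>2 * expectation (loc_spread t)
        + 9 * a\<^sup>2 * expectation (\<lambda>\<omega>. (norm (mean_noise t \<omega>))\<^sup>2))"
    by (simp add: drift_err_orthogonal)
  also have "\<dots> \<le> expectation (lyap t) - a * \<eta>x / 2 * expectation (stationarity t)
    + (\<eta>x + \<eta>y) * (3 * a * L\<^sup>2 * (2 * C * (real \<tau>)\<^sup>2) + 9 * a\<^sup>2 * (\<sigma>\<^sup>2 / real n))"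
    using a \<eta>x \<eta>y_pos
    by (intro add_left_mono mult_left_mono add_mono loc_spread_bound mean_noise_second_moment) auto
  finally show ?thesis by (simp add: mult_ac)
qed

lemma expected_lyap_0_le:
  "expectation (lyap 0) \<le> \<Phi> x0 + gap F (x0, y0) / 6 + (\<eta>x + \<eta>y) * \<sigma>\<^sup>2"
proof -
  let ?N = "\<lambda>i. noise f g i 0 (\<lambda>_. (x0, y0))"
  have mp: "mean_pos 0 \<omega> = (x0, y0)" for \<omega>
    by (simp add: mean_pos_def pos_0 avg_const[OF n])
  \<comment> \<open>All clients start at the same point, so the initial momentum error is pure
    averaged noise.\<close>
  have e0: "err 0 \<omega> = avg n (\<lambda>i. ?N i \<omega>)" for \<omega>
    by (simp add: err_def mp mean_dir_def dir_0 avg_add gradient_F)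
  have "expectation (\<lambda>\<omega>. (norm (err 0 \<omega>))\<^sup>2) \<le> \<sigma>\<^sup>2 / real n"
    unfolding e0 by (rule noise_avg_second_moment[where A="{}"]) auto
  also have "\<dots> \<le> \<sigma>\<^sup>2" using n by (simp add: divide_le_eq mult_le_cancel_left1)
  finally have "(\<eta>x + \<eta>y) * expectation (\<lambda>\<omega>. (norm (err 0 \<omega>))\<^sup>2) \<le> (\<eta>x + \<eta>y) * \<sigma>\<^sup>2"
    using \<eta>x \<eta>y_pos by (intro mult_left_mono) auto
  moreover have "expectation (lyap 0) = \<Phi> x0 + gap F (x0, y0) / 6
      + (\<eta>x + \<eta>y) * expectation (\<lambda>\<omega>. (norm (err 0 \<omega>))\<^sup>2)"
    unfolding lyap_def[abs_def] mp using sq_int_integrable[OF err_sq_int] by (simp add: prob_space)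
  ultimately show ?thesis by simp
qed

lemma sum_stationarity_le:
  assumes \<Delta>: "\<And>x. \<Phi> x0 - \<Phi> x \<le> \<Delta>\<Phi>" "gap F (x0, y0) \<le> \<Delta>y"
  shows "a * \<eta>x / 2 * (\<Sum>t<T. expectation (stationarity t)) \<le> \<Delta>\<Phi> + \<Delta>y / 6 + (\<eta>x + \<eta>y) * \<sigma>\<^sup>2
    + real T * ((\<eta>x + \<eta>y) * (6 * a * L\<^sup>2 * C * (real \<tau>)\<^sup>2 + 9 * a\<^sup>2 * (\<sigma>\<^sup>2 / real n)))"
proof -
  let ?E = "(\<eta>x + \<eta>y) * (6 * a * L\<^sup>2 * C * (real \<tau>)\<^sup>2 + 9 * a\<^sup>2 * (\<sigma>\<^sup>2 / real n))"
  have tel: "expectation (lyap T) + a * \<eta>x / 2 * (\<Sum>t<T. expectation (stationarity t))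
      \<le> expectation (lyap 0) + real T * ?E" for T
  proof (induction T)
    case (Suc T)
    have "a * \<eta>x / 2 * (\<Sum>t<Suc T. expectation (stationarity t)) =
        a * \<eta>x / 2 * (\<Sum>t<T. expectation (stationarity t)) + a * \<eta>x / 2 * expectation (stationarity T)"
      by (simp add: distrib_left)
    moreover have "real (Suc T) * ?E = real T * ?E + ?E"
      by (simp only: of_nat_Suc distrib_right mult_1_left add.commute)
    ultimately show ?case using expected_lyap_Suc_le[of T] Suc by linarith
  qed simp
  \<comment> \<open>To close the telescope, the final Lyapunov value is bounded below: its other
    summands are nonnegative and \<open>\<Phi>\<close> is at least
    \<open>\<Phi> x0 - \<Delta>\<Phi>\<close>.\<close>
  have "\<Phi> x0 - \<Delta>\<Phi> = expectation (\<lambda>\<omega>. \<Phi> x0 - \<Delta>\<Phi>)" by (simp add: prob_space)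
  also have "\<dots> \<le> expectation (lyap T)"
  proof (intro integral_mono lyap_integrable)
    show "\<Phi> x0 - \<Delta>\<Phi> \<le> lyap T \<omega>" for \<omega>
    proof -
      have "0 \<le> gap F (mean_pos T \<omega>) / 6 + (\<eta>x + \<eta>y) * (norm (err T \<omega>))\<^sup>2"
        using gap_ge0 \<eta>x \<eta>y_pos by (intro add_nonneg_nonneg mult_nonneg_nonneg) auto
      then show ?thesis using \<Delta>(1)[of "fst (mean_pos T \<omega>)"] unfolding lyap_def by linarith
    qed
  qed simp
  finally show ?thesis using tel[of T] expected_lyap_0_le \<Delta>(2) by linarith
qed

lemma avg_iterate_eq: "avg_iterate n \<tau> \<eta>x \<eta>y 3 3 (\<lambda>_. a) g \<xi> x0 y0 t \<omega> = fst (mean_pos t \<omega>)"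
  by (simp add: avg_iterate_def mean_pos_def pos_def state_def avg_Pair)

text \<open>The telescoped bound divided by \<open>a * \<eta>x * T / 2\<close>. For fixed
  \<open>\<eta>x\<close> and \<open>\<eta>y\<close> the errors depend on the parameters through
  \<open>a * T\<close>, \<open>a * \<tau>\<close> and \<open>a / n\<close>, later chosen of orders
  \<open>q ^ 2\<close>, \<open>1 / q\<close> and \<open>1 / q ^ 2\<close>.\<close>

lemma accurate_if:
  assumes \<Delta>: "\<And>x. \<Phi> x0 - \<Phi> x \<le> \<Delta>\<Phi>" "gap F (x0, y0) \<le> \<Delta>y" and T: "T \<ge> 1" and \<epsilon>: "\<epsilon> > 0"
    and le: "2 / \<eta>x * ((\<Delta>\<Phi> + \<Delta>y / 6 + (\<eta>x + \<eta>y) * \<sigma>\<^sup>2) / (a * real T)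
      + (\<eta>x + \<eta>y) * (6 * L\<^sup>2 * \<eta>y\<^sup>2 * B * (a * real \<tau>)\<^sup>2 + 9 * \<sigma>\<^sup>2 * (a / real n))) \<le> \<epsilon>\<^sup>2"
  shows "accurate_output M \<Phi> T (avg_iterate n \<tau> \<eta>x \<eta>y 3 3 (\<lambda>_. a) g \<xi> x0 y0) \<epsilon>"
proof -
  let ?S = "\<Sum>t<T. expectation (stationarity t)"
    and ?\<Delta> = "\<Delta>\<Phi> + \<Delta>y / 6 + (\<eta>x + \<eta>y) * \<sigma>\<^sup>2"
    and ?R = "6 * L\<^sup>2 * \<eta>y\<^sup>2 * B * (a * real \<tau>)\<^sup>2 + 9 * \<sigma>\<^sup>2 * (a / real n)"
  have "6 * a * L\<^sup>2 * C * (real \<tau>)\<^sup>2 + 9 * a\<^sup>2 * (\<sigma>\<^sup>2 / real n) = a * ?R"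
    by (simp add: C_def power_mult_distrib power2_eq_square algebra_simps)
  with sum_stationarity_le[OF \<Delta>, of T]
  have "a * \<eta>x / 2 * ?S \<le> ?\<Delta> + real T * ((\<eta>x + \<eta>y) * (a * ?R))" by simp
  also have "\<dots> = (a * \<eta>x / 2) * (real T * (2 / \<eta>x * (?\<Delta> / (a * real T) + (\<eta>x + \<eta>y) * ?R)))"
  proof -
    have "D + t * (e * (a * R)) = (a * x / 2) * (t * (2 / x * (D / (a * t) + e * R)))"
      if "x > 0" "t > 0" for D t e R x :: real
      using that a by (simp add: field_simps)
    from this[OF \<eta>x(1)] show ?thesis using T by simp
  qed
  also have "\<dots> \<le> (a * \<eta>x / 2) * (real T * \<epsilon>\<^sup>2)"
    using le a \<eta>x by (intro mult_left_mono) auto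
  finally have S: "?S \<le> real T * \<epsilon>\<^sup>2"
    using a \<eta>x by (simp add: mult_le_cancel_left)
  show ?thesis
    by (rule accurate_outputI[OF prob_space_axioms \<Phi>_quad_bound k_pos T \<epsilon>])
      (use S fst_mean_pos_sq_int sq_int_integrable[OF \<Phi>_gradient_sq_int] in
        \<open>auto simp: avg_iterate_eq[abs_def] avg_iterate_eq stationarity_def[abs_def] sq_int_def\<close>)
qed

end

section \<open>Choice of the parameters\<close>

lemma bounded_heterogeneity_gradient:
  fixes f :: "nat \<Rightarrow> 'a::euclidean_space \<times> 'b::euclidean_space \<Rightarrow> real"
  assumes "bounded_heterogeneity \<zeta>x \<zeta>y n f"
  shows "avg n (\<lambda>i. (norm (gradient (f i) z - gradient (global_fun n f) z))\<^sup>2) \<le> \<zeta>x\<^sup>2 + \<zeta>y\<^sup>2"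
proof -
  let ?F = "global_fun n f"
  let ?hx = "heterogeneity_at (grad_x ?F) n (\<lambda>i. grad_x (f i))"
    and ?hy = "heterogeneity_at (grad_y ?F) n (\<lambda>i. grad_y (f i))"
  have bx: "bdd_above (range ?hx)" "(SUP z. ?hx z) \<le> \<zeta>x\<^sup>2"
    and bdy: "bdd_above (range ?hy)" "(SUP z. ?hy z) \<le> \<zeta>y\<^sup>2"
    using assms by (auto simp: bounded_heterogeneity_def Let_def)
  have x: "?hx z \<le> \<zeta>x\<^sup>2" using cSUP_upper[OF UNIV_I bx(1), of z] bx(2) by (rule order_trans)
  have y: "?hy z \<le> \<zeta>y\<^sup>2" using cSUP_upper[OF UNIV_I bdy(1), of z] bdy(2) by (rule order_trans)
  have "avg n (\<lambda>i. (norm (gradient (f i) z - gradient ?F z))\<^sup>2) = ?hx z + ?hy z"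
    unfolding heterogeneity_at_def avg_add[symmetric]
    by (simp add: norm_sq_fst_snd[of "_ - _"] grad_x_def grad_y_def)
  with x y show ?thesis by linarith
qed

text \<open>\<open>a1\<close> is the largest admissible step; the factor
  \<open>1 + 1 / root 4 c\<close> pays for rounding \<open>q / n\<close> up to an integer.\<close>

lemma parameter_choice:
  fixes n T :: nat and c a1 :: real
  assumes n: "n \<ge> 1" and T: "T \<ge> 1" and c: "c > 0" and Tc: "c * real n ^ 3 \<le> real T" and a1: "a1 > 0"
  defines "q \<equiv> root 4 (real n * real T)"
  defines "\<tau> \<equiv> nat \<lceil>q / real n\<rceil>"
  defines "a \<equiv> a1 / (1 + 1 / root 4 c) * (real n / q\<^sup>2)"
  shows "q \<ge> 1" "q ^ 4 = real n * real T" "\<tau> \<ge> 1" "q / real n \<le> real \<tau>" "a > 0"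
    and "a * real \<tau> \<le> a1 / q"
proof -
  let ?r = "root 4 c"
  have r: "?r > 0" using c by simp
  have nT: "1 \<le> real n * real T" using mult_mono[of 1 "real n" 1 "real T"] n T by simp
  then show q1: "q \<ge> 1" by (simp add: q_def)
  show q4: "q ^ 4 = real n * real T" by (simp add: q_def)
  have n0: "real n > 0" using n by simp
  have qn: "0 < q / real n" using q1 n0 by simp
  show \<tau>: "\<tau> \<ge> 1" using qn by (simp add: \<tau>_def Suc_le_eq)
  show "q / real n \<le> real \<tau>" unfolding \<tau>_def by (rule real_nat_ceiling_ge)
  show a: "a > 0" using r a1 n0 q1 by (simp add: a_def add_pos_pos)
  \<comment> \<open>In fourth powers the lower bound on \<open>T\<close> reads
    \<open>root 4 c \<le> q / n\<close>.\<close>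
  have "(?r * real n) ^ 4 = real n * (c * real n ^ 3)"
    using c by (simp add: power_mult_distrib) (simp add: eval_nat_numeral)
  also have "\<dots> \<le> q ^ 4" unfolding q4 using Tc by (intro mult_left_mono) auto
  finally have "?r * real n \<le> q"
    using power_mono_iff[of "?r * real n" q 4] r q1 n0 by simp
  then have "1 \<le> q / real n / ?r" using r n0 by (simp add: field_simps)
  moreover have "real \<tau> \<le> q / real n + 1"
    unfolding \<tau>_def using qn by linarith
  ultimately have "real \<tau> \<le> (1 + 1 / ?r) * (q / real n)"
    by (simp add: algebra_simps)
  then have "a * real \<tau> \<le> a * ((1 + 1 / ?r) * (q / real n))"
    using a by (intro mult_left_mono) auto
  also have "\<dots> = a1 / q"
  proof -
    have "a1 / s * (m / q\<^sup>2) * (s * (q / m)) = a1 / q" if "s > 0" "m > 0" for s m :: real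
      using that q1 by (simp add: field_simps power2_eq_square)
    from this[of "1 + 1 / ?r" "real n"] show ?thesis
      using r n0 unfolding a_def by (simp only: add_pos_pos zero_less_one zero_less_divide_1_iff)
  qed
  finally show "a * real \<tau> \<le> a1 / q" .
qed

text \<open>From \<open>q ^ 4 = n * T\<close> the ratio is at most \<open>n * T / q = q ^ 3\<close>;
  rounding up adds at most 1, again at most \<open>q ^ 3\<close>.\<close>

lemma communication_rounds_le:
  fixes n T \<tau> :: nat
  assumes "n \<ge> 1" "q \<ge> 1" "q ^ 4 = real n * real T" "q / real n \<le> real \<tau>"
  shows "real (communication_rounds T \<tau>) \<le> 2 * q ^ 3"
proof -
  have qn: "0 < q / real n" using assms by simp
  have "real T / real \<tau> \<le> real T / (q / real n)"
    using qn less_le_trans[OF qn assms(4)] assms(4) by (intro divide_left_mono mult_pos_pos) auto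
  also have "\<dots> = q ^ 4 / q" using assms by simp
  also have "\<dots> = q ^ 3" using assms(2) by (simp add: eval_nat_numeral)
  finally have "real T / real \<tau> \<le> q ^ 3" .
  moreover have "1 \<le> q ^ 3" using assms(2) by simp
  moreover have "real (communication_rounds T \<tau>) \<le> real T / real \<tau> + 1"
    unfolding communication_rounds_def
    using zero_le_divide_iff[of "real T" "real \<tau>"] by simp
  ultimately show ?thesis by linarith
qed

text \<open>\<open>C\<close>, \<open>C'\<close> and \<open>\<eta>y\<close> precede all instances, so
  they are uniform in the number of clients and the accuracy. The premise with the floor says that
  the largest integer within the complexity budget is at least 1 and at least
  \<open>c * n ^ 3\<close>; this integer is the \<open>T\<close> used.\<close>

theorem corollary2:
  fixes Lf \<mu> \<sigma> \<zeta>x \<zeta>y \<Delta>\<Phi> \<Delta>y c \<kappa> :: real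
  assumes "Lf > 0" and "\<mu> > 0" and "\<sigma> > 0" and "\<zeta>x \<ge> 0" and "\<zeta>y \<ge> 0" and "c > 0"
    and "\<kappa> = Lf / \<mu>"
  shows "\<exists>C>0. \<exists>C'>0. \<exists>\<eta>y>0.
    \<forall>(n::nat) (M::'w measure) (D::nat \<Rightarrow> 's measure)
      (loss::'a::euclidean_space \<times> 'b::euclidean_space \<Rightarrow> 's \<Rightarrow> real) g \<xi> x0 y0 (\<epsilon>::real).
      minimax_instance Lf \<mu> \<sigma> \<zeta>x \<zeta>y \<Delta>\<Phi> \<Delta>y n M D loss g \<xi> x0 y0 \<and> \<epsilon> > 0 \<and>
      max 1 (c * real n ^ 3) \<le> of_int \<lfloor>C * (\<kappa> ^ 4 / (real n * \<epsilon> ^ 4))\<rfloor> \<longrightarrow>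
      (\<exists>(T::nat) (\<tau>::nat) \<eta>x \<alpha>.
         T \<ge> 1 \<and> \<tau> \<ge> 1 \<and> \<eta>x > 0 \<and> \<alpha> > 0 \<and> real T \<ge> c * real n ^ 3 \<and>
         real T \<le> C * (\<kappa> ^ 4 / (real n * \<epsilon> ^ 4)) \<and>
         real (communication_rounds T \<tau>) \<le> C' * (\<kappa> ^ 3 / \<epsilon> ^ 3) \<and>
         accurate_output M (max_y (global_fun n (local_fun D loss))) T
           (avg_iterate n \<tau> \<eta>x \<eta>y 3 3 (\<lambda>_. \<alpha>) g \<xi> x0 y0) \<epsilon>)"
proof -
  have \<kappa>: "\<kappa> > 0" using assms by simp
  define k where "k = 2 * Lf + Lf\<^sup>2 / (2 * \<mu>) + \<mu>"
  define \<eta>y where "\<eta>y = 1 / (6 * Lf)"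
  define \<eta>x where "\<eta>x = \<mu> * \<eta>y / (26 * k)"
  \<comment> \<open>Collects the limits \<open>3 * a \<le> 1\<close> and
    \<open>k * a * \<eta>y \<le> 1 / 4\<close>; the limit on \<open>a * \<tau>\<close> follows
    because \<open>a1 \<le> 1 / 3\<close>.\<close>
  define a1 where "a1 = min (1 / 3) (1 / (4 * k * \<eta>y))"
  define a0 where "a0 = a1 / (1 + 1 / root 4 c)"
  define Z where "Z = \<zeta>x\<^sup>2 + \<zeta>y\<^sup>2"
  have k: "k > 0" using assms by (auto simp: k_def intro!: add_pos_pos)
  have \<eta>y: "\<eta>y > 0" using assms by (simp add: \<eta>y_def)
  have \<eta>x: "\<eta>x > 0" using assms k \<eta>y by (simp add: \<eta>x_def)
  have a1: "a1 > 0" using k \<eta>y by (simp add: a1_def)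
  have a0: "a0 > 0" using a1 assms by (simp add: a0_def add_pos_pos)
  \<comment> \<open>Chosen so that the error in \<open>accurate_if\<close> is at most
    \<open>K / q\<^sup>2\<close>. The absolute values cover \<open>\<Delta>\<Phi>\<close> and
    \<open>\<Delta>y\<close> of either sign.\<close>
  define K where "K = 2 / \<eta>x * ((\<bar>\<Delta>\<Phi>\<bar> + \<bar>\<Delta>y\<bar> / 6 + (\<eta>x + \<eta>y) * \<sigma>\<^sup>2) / a0
      + (\<eta>x + \<eta>y) * (6 * Lf\<^sup>2 * \<eta>y\<^sup>2 * (6 * (\<sigma>\<^sup>2 + Z)) * a1\<^sup>2 + 9 * \<sigma>\<^sup>2 * a0))"
  have K: "K > 0"
  proof -
    have "(\<bar>\<Delta>\<Phi>\<bar> + \<bar>\<Delta>y\<bar> / 6 + (\<eta>x + \<eta>y) * \<sigma>\<^sup>2) / a0 > 0"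
      using a0 \<eta>x \<eta>y assms by (intro divide_pos_pos add_nonneg_pos) auto
    moreover have "(\<eta>x + \<eta>y) * (6 * Lf\<^sup>2 * \<eta>y\<^sup>2 * (6 * (\<sigma>\<^sup>2 + Z)) * a1\<^sup>2 + 9 * \<sigma>\<^sup>2 * a0) \<ge> 0"
      using a0 \<eta>x \<eta>y
      by (intro mult_nonneg_nonneg add_nonneg_nonneg) (auto simp: Z_def)
    ultimately show ?thesis unfolding K_def using \<eta>x by (intro mult_pos_pos add_pos_nonneg) auto
  qed
  \<comment> \<open>The budget becomes \<open>2 * K\<^sup>2 / (n * \<epsilon> ^ 4)\<close>, the
    power of \<open>\<kappa>\<close> being cancelled by a constant that may depend on the moduli.
    The factor 2 compensates for rounding \<open>T\<close> down.\<close>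
  define C where "C = 2 * K\<^sup>2 / \<kappa> ^ 4"
  have C: "C > 0" using K \<kappa> by (simp add: C_def)
  define C' where "C' = 2 * root 4 C ^ 3"
  have C': "C' > 0" using C by (simp add: C'_def)
  have main: "\<exists>(T::nat) (\<tau>::nat) \<eta>x \<alpha>.
         T \<ge> 1 \<and> \<tau> \<ge> 1 \<and> \<eta>x > 0 \<and> \<alpha> > 0 \<and> real T \<ge> c * real n ^ 3 \<and>
         real T \<le> C * (\<kappa> ^ 4 / (real n * \<epsilon> ^ 4)) \<and>
         real (communication_rounds T \<tau>) \<le> C' * (\<kappa> ^ 3 / \<epsilon> ^ 3) \<and>
         accurate_output M (max_y (global_fun n (local_fun D loss))) T
           (avg_iterate n \<tau> \<eta>x \<eta>y 3 3 (\<lambda>_. \<alpha>) g \<xi> x0 y0) \<epsilon>"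
    if inst: "minimax_instance Lf \<mu> \<sigma> \<zeta>x \<zeta>y \<Delta>\<Phi> \<Delta>y n M D loss g \<xi> x0 y0" and \<epsilon>: "\<epsilon> > 0"
      and large: "max 1 (c * real n ^ 3) \<le> of_int \<lfloor>C * (\<kappa> ^ 4 / (real n * \<epsilon> ^ 4))\<rfloor>"
    for n :: nat and M :: "'w measure" and D :: "nat \<Rightarrow> 's measure"
      and loss :: "'a \<times> 'b \<Rightarrow> 's \<Rightarrow> real" and g \<xi> x0 y0 and \<epsilon> :: real
  proof -
    define f where "f = local_fun D loss"
    define b where "b = C * (\<kappa> ^ 4 / (real n * \<epsilon> ^ 4))"
    define T where "T = nat \<lfloor>b\<rfloor>"
    have n: "n \<ge> 1" using inst by (simp add: minimax_instance_def Let_def)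
    have n0: "real n > 0" using n by simp
    have fl: "1 \<le> real_of_int \<lfloor>b\<rfloor>" "c * real n ^ 3 \<le> of_int \<lfloor>b\<rfloor>"
      using large by (auto simp: b_def)
    then have Tr: "real T = of_int \<lfloor>b\<rfloor>" by (simp add: T_def)
    have T1: "T \<ge> 1" using fl(1) unfolding Tr[symmetric] by simp
    have Tc: "c * real n ^ 3 \<le> real T" using fl(2) Tr by simp
    have Tb: "real T \<le> b" unfolding Tr by simp
    \<comment> \<open>Rounding down at most halves a number whose floor is at least 1.\<close>
    have bT: "b < 2 * real T"
      using fl(1) unfolding Tr by linarith
    define q where "q = root 4 (real n * real T)"
    define \<tau> where "\<tau> = nat \<lceil>q / real n\<rceil>"
    define a where "a = a0 * (real n / q\<^sup>2)"
    note par = parameter_choice[OF n T1 assms(6) Tc a1, folded q_def a0_def,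
        folded \<tau>_def a_def]
    have q0: "q > 0" using par(1) by simp
    have a_tau: "a * real \<tau> \<le> a1"
      using par(6) divide_left_mono[OF par(1), of a1] a1 q0 by simp
    have a_le: "a \<le> a1"
    proof -
      have "a * 1 \<le> a * real \<tau>" using par(3,5) by (intro mult_left_mono) auto
      with a_tau show ?thesis by simp
    qed
    interpret S: local_sgda M n D \<xi> f g x0 y0 \<tau> Lf \<mu> \<sigma> Z k \<eta>x \<eta>y a
    proof (intro local_sgda.intro fresh_sampling.intro fresh_sampling_axioms.intro
        local_sgda_axioms.intro)
      show "prob_space M" "fresh_samples M n D \<xi>" "\<And>i. i < n \<Longrightarrow> prob_space (D i)"
        "smooth_clients Lf n f" "bounded_variance \<sigma> n D f g" "PL_in_y \<mu> (global_fun n f)"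
        using inst by (auto simp: minimax_instance_def Let_def f_def)
      show "avg n (\<lambda>i. (norm (gradient (f i) z - gradient (global_fun n f) z))\<^sup>2) \<le> Z" for z
        unfolding Z_def using inst
        by (intro bounded_heterogeneity_gradient) (simp add: minimax_instance_def Let_def f_def)
      show "2 * Lf + Lf\<^sup>2 / (2 * \<mu>) \<le> k" "\<mu> \<le> k"
        using assms(1,2) by (auto simp: k_def)
      show "26 * k * \<eta>x \<le> \<mu> * \<eta>y" using k by (simp add: \<eta>x_def)
      show "6 * Lf * \<eta>y \<le> 1" using assms(1) by (simp add: \<eta>y_def)
      show "3 * a \<le> 1" "a * real \<tau> \<le> 1" using a_le a_tau by (auto simp: a1_def)
      have "a \<le> 1 / (4 * k * \<eta>y)" using a_le by (simp add: a1_def)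
      then show "k * a * \<eta>y \<le> 1 / 4" using k \<eta>y by (simp add: field_simps)
    qed (use n assms \<eta>x par in auto)
    have init: "max_y (global_fun n f) x0 - max_y (global_fun n f) x \<le> \<bar>\<Delta>\<Phi>\<bar>"
        "gap (global_fun n f) (x0, y0) \<le> \<bar>\<Delta>y\<bar>" for x
      using inst by (auto simp: minimax_instance_def Let_def f_def gap_def intro: order_trans[OF _ abs_ge_self])
    have "K / q\<^sup>2 \<le> \<epsilon>\<^sup>2"
    proof -
      have "b * (real n * \<epsilon> ^ 4) = 2 * K\<^sup>2"
        using n0 \<epsilon> \<kappa> by (simp add: b_def C_def)
      moreover have "b * (real n * \<epsilon> ^ 4) \<le> (2 * real T) * (real n * \<epsilon> ^ 4)"
        using bT n0 \<epsilon> by (intro mult_right_mono) auto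
      ultimately have "K\<^sup>2 \<le> q ^ 4 * \<epsilon> ^ 4" unfolding par(2) by (simp add: mult_ac)
      also have "\<dots> = (q\<^sup>2 * \<epsilon>\<^sup>2)\<^sup>2" by (simp add: power_mult_distrib)
      finally have "K \<le> q\<^sup>2 * \<epsilon>\<^sup>2" by (rule power2_le_imp_le) simp
      then show ?thesis using q0 by (simp add: field_simps)
    qed
    moreover have "2 / \<eta>x * ((\<bar>\<Delta>\<Phi>\<bar> + \<bar>\<Delta>y\<bar> / 6 + (\<eta>x + \<eta>y) * \<sigma>\<^sup>2) / (a * real T)
        + (\<eta>x + \<eta>y) * (6 * Lf\<^sup>2 * \<eta>y\<^sup>2 * S.B * (a * real \<tau>)\<^sup>2 + 9 * \<sigma>\<^sup>2 * (a / real n))) \<le> K / q\<^sup>2"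
    proof -
      have aT: "a * real T = a0 * q\<^sup>2"
      proof -
        have "a * real T = a0 * (real n * real T) / q\<^sup>2" by (simp add: a_def)
        also have "\<dots> = a0 * q\<^sup>2" unfolding par(2)[symmetric] using q0
          by (simp add: power2_eq_square eval_nat_numeral)
        finally show ?thesis .
      qed
      have an: "a / real n = a0 / q\<^sup>2" using n0 by (simp add: a_def)
      have "(a * real \<tau>)\<^sup>2 \<le> (a1 / q)\<^sup>2" using par(5,6) by (intro power_mono) auto
      then have "2 / \<eta>x * ((\<bar>\<Delta>\<Phi>\<bar> + \<bar>\<Delta>y\<bar> / 6 + (\<eta>x + \<eta>y) * \<sigma>\<^sup>2) / (a * real T)
          + (\<eta>x + \<eta>y) * (6 * Lf\<^sup>2 * \<eta>y\<^sup>2 * S.B * (a * real \<tau>)\<^sup>2 + 9 * \<sigma>\<^sup>2 * (a / real n)))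
        \<le> 2 / \<eta>x * ((\<bar>\<Delta>\<Phi>\<bar> + \<bar>\<Delta>y\<bar> / 6 + (\<eta>x + \<eta>y) * \<sigma>\<^sup>2) / (a0 * q\<^sup>2)
          + (\<eta>x + \<eta>y) * (6 * Lf\<^sup>2 * \<eta>y\<^sup>2 * S.B * (a1 / q)\<^sup>2 + 9 * \<sigma>\<^sup>2 * (a0 / q\<^sup>2)))"
        unfolding aT an using \<eta>x \<eta>y S.B_nonneg by (intro mult_left_mono add_left_mono add_right_mono) auto
      also have "\<dots> = K / q\<^sup>2"
      proof -
        have "2 / x * (A / (s * p) + e * (m * (w / q)\<^sup>2 + v * (s / p)))
            = 2 / x * (A / s + e * (m * w\<^sup>2 + v * s)) / p"
          if "s > 0" "x > 0" "p = q\<^sup>2" for x A s p e m w v :: real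
          using that q0 by (simp add: power_divide) (simp add: field_simps)
        from this[OF a0 \<eta>x refl] show ?thesis unfolding K_def S.B_def .
      qed
      finally show ?thesis .
    qed
    ultimately have acc: "accurate_output M (max_y (global_fun n f)) T
        (avg_iterate n \<tau> \<eta>x \<eta>y 3 3 (\<lambda>_. a) g \<xi> x0 y0) \<epsilon>"
      by (intro S.accurate_if[OF init T1 \<epsilon>]) linarith
    \<comment> \<open>The upper bound on \<open>T\<close>, read as an upper bound on
      \<open>q\<close>, turns the \<open>2 * q ^ 3\<close> rounds into the claimed order.\<close>
    have "q ^ 4 \<le> (root 4 C * \<kappa> / \<epsilon>) ^ 4"
    proof -
      have "q ^ 4 \<le> real n * b" unfolding par(2) using Tb by (intro mult_left_mono) auto
      also have "\<dots> = (root 4 C * \<kappa> / \<epsilon>) ^ 4"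
        using n0 C by (simp add: b_def power_divide power_mult_distrib)
      finally show ?thesis .
    qed
    then have "q \<le> root 4 C * \<kappa> / \<epsilon>"
      using C \<kappa> \<epsilon> q0 by (subst (asm) power_mono_iff) auto
    then have "q ^ 3 \<le> (root 4 C * \<kappa> / \<epsilon>) ^ 3" using q0 by (intro power_mono) auto
    then have rounds: "real (communication_rounds T \<tau>) \<le> C' * (\<kappa> ^ 3 / \<epsilon> ^ 3)"
      using communication_rounds_le[OF n par(1,2,4)]
      by (simp add: C'_def power_divide power_mult_distrib)
    show ?thesis
      by (rule exI[of _ T], rule exI[of _ \<tau>], rule exI[of _ \<eta>x], rule exI[of _ a])
        (use T1 par(3,5) \<eta>x Tc Tb rounds acc in \<open>simp add: b_def f_def\<close>)
  qed
  show ?thesis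
    using C C' \<eta>y main by (intro exI[of _ C] exI[of _ C'] exI[of _ \<eta>y] conjI allI impI) auto
qed

end
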